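(* Let $2\le k<\ell$ be integers and $N=(k-1)(\ell-1)$. Let $\psi^*:\mathcal F_{>0,\mathrm{GSV}}\to\mathcal F_{>0,\mathrm{cyc}}$ be the homomorphism of semifields given by $$\psi^*(x_i)=\overline{x}_i\prod_{b=i}^{N-1}\overline{x}_{N+(b+k\bmod\ell)}\ \ (1\le i\le N),\qquad \psi^*(M_{i,i})=\psi^*(M_{i-k-1,i-1})=\overline{x}_{N+(i-1\bmod\ell)}\ \ (i\in\mathbb Z),$$ $$\psi^*(\tilde c_s)=z_s\prod_{i=1}^{\ell}\overline{x}_{N+i}\ \ (1\le s\le k-1),$$ where residues mod $\ell$ are taken in $\{1,\dots,\ell\}$. Then $\psi^*$ is a quasi-homomorphism from $\mathcal A_{\mathrm{GSV}}(k,\ell)$ to $\mathcal A_{\mathrm{cyc}}(k,\ell)$. That is, $\psi^*(\mathbb P_{\mathrm{GSV}})\subset\mathbb P_{\mathrm{cyc}}$; $\psi^*(x_i)/\overline x_i\in\mathbb P_{\mathrm{cyc}}$ for $1\le i\le N$; and $\psi^*(\hat y_{i;s})=\overline{\hat y}_{i;s}$ for all $1\le i\le N$ and $1\le s\le d_i$, where $d_1=k$ and $d_i=1$ for $i\ge2$.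
   Context: **Generalities.** A (non-normalized) generalized seed over an abelian group $\mathbb P$ consists of cluster variables $x_1,\dots,x_N$, an exchange matrix $B=(b_{ij})$, exchange degrees $d_i$, and coefficients $p_{i;s}\in\mathbb P$ ($0\le s\le d_i$), encoding the exchange relations $x_ix_i'=\sum_{s}p_{i;s}(M_i^+)^s(M_i^-)^{d_i-s}$, $M_i^\pm=\prod_jx_j^{[\pm b_{ji}]_+}$. Put $\hat y_{i;s}=\frac{p_{i;s}}{p_{i;0}}\left(M_i^+/M_i^-\right)^s$. Two seeds over the same $\mathbb P$, with the same degrees, satisfy $\Sigma\sim\Sigma'$ if $x_i/x_i'\in\mathbb P$ for all $i$ and $\hat y_{i;s}=\hat y'_{i;s}$ for all $i,s$. $\mathcal F_{>0}$ denotes the semifield of subtraction-free rational expressions in the cluster variables with coefficients in $\mathbb P$. A semifield homomorphism $\psi:\mathcal F_{>0}\to\overline{\mathcal F}_{>0}$ is a quasi-homomorphism of the generalized cluster algebras with initial seeds $\Sigma,\overline\Sigma$ if $\psi(\mathbb P)\subset\overline{\mathbb P}$ and $\psi(\Sigma)\sim\overline\Sigma$. **The algebra $\mathcal A_{\mathrm{cyc}}(k,\ell)$.** Indeterminates $\overline x_1,\dots,\overline x_N$ (mutable), $\overline x_{N+1},\dots,\overline x_{N+\ell}$ (frozen), and $z_1,\dots,z_{k-1}$ with $z_s=z_{k-s}$; $z_0=z_k=1$. $\mathbb P_{\mathrm{cyc}}$ is the group of Laurent monomials in the frozen variables and the $z_s$. The extended quiver has arrows $\overline x_{i+1}\to\overline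 x_i\to\overline x_{i+\ell}\to\overline x_{i+1}$ for $i=1,\dots,N$, and $b_{ji}$ is the number of arrows $j\to i$ minus the number of arrows $i\to j$. The exchange polynomial of $\overline x_1$ is $\sum_{s=0}^kz_s\overline x_2^s\overline x_{\ell+1}^{k-s}$, the others are binomial. Thus $\overline{\hat y}_{1;s}=z_s(\overline x_2/\overline x_{\ell+1})^s$ and, for $2\le i\le N$, $\overline{\hat y}_{i;1}=\frac{\overline x_{i+1}\,\overline x_{i-\ell}\,\overline x_{i+\ell-1}}{\overline x_{i+\ell}\,\overline x_{i-1}\,\overline x_{i-\ell+1}}$, where for $i\le\ell$ the factors $\overline x_{i-\ell}$ and $\overline x_{i-\ell+1}$ are omitted. **The algebra $\mathcal A_{\mathrm{GSV}}(k,\ell)$** (Gekhtman–Shapiro–Vainshtein). $\mathrm{Band}(k,\ell)$ is the space of matrices $M=(M_{ij})_{i,j\in\mathbb Z}$ with $M_{ij}=0$ unless $0\le j-i\le k$ and $M_{i+\ell,j+\ell}=M_{ij}$. Let $A,B$ be the $\ell\times\ell$ matrices with $B_{ij}=M_{i,k+j}$ and $A_{i,\ell-k+j}=M_{i,j}$ for $1\le j\le k$, the first $\ell-k$ columns of $A$ being zero. Let $c_s$ be the coefficient of $t^{\ell-s}$ in $\det(tB+A)$ and $\tilde c_s=(-1)^{s(\ell-s)}c_s$. For $1\le i\le N$, $x_i$ is the minor of $M$ with column set $[k+i,(k-1)\ell+1]$ and row set the $N-i+1$ largest elements of $\{j\in[(k-1)\ell]:j\not\equiv1\bmod\ell\}$.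 The functions $x_1,\dots,x_N$, $M_{i,i},M_{i,i+k}$ ($1\le i\le\ell$), $\tilde c_1,\dots,\tilde c_{k-1}$ are algebraically independent; $\mathbb P_{\mathrm{GSV}}$ is the group of Laurent monomials in the $M_{i,i}$, $M_{i,i+k}$, $\tilde c_s$. The initial seed has cluster variables $x_1,\dots,x_N$, $d_1=k$, $d_i=1$ for $i\geq 2$, and $$\hat y_{1;s}=\frac{p_{1;s}}{p_{1;0}}\Big(\frac{x_2}{x_{\ell+1}}\Big)^s,\quad p_{1;0}=\prod_{i=1}^\ell M_{i,i}\prod_{i=2}^\ell M_{i,i+k}^{k-1},\quad p_{1;s}=\tilde c_s\prod_{i=2}^\ell M_{i,i+k}^{k-1-s}\ (1\le s\le k-1),\quad p_{1;k}=M_{1,k+1},$$ where, if $k=2$, the symbol $x_{\ell+1}$ is to be read as $1/M_{2,2}$; and for $2\le i\le N$ $$\hat y_{i;1}=\frac{x_{i+1}\,x_{i-\ell}\,x_{i+\ell-1}}{x_{i+\ell}\,x_{i-1}\,x_{i-\ell+1}}\cdot M_{i,i+k}^{\epsilon_i}\,M_{i+k-1,i+k-1}^{\delta_i},$$ where $\epsilon_i=1$ if $2\le i\le\ell$ and $0$ otherwise, $\delta_i=1$ if $N-\ell+2\le i\le N$ and $0$ otherwise, factors $x_m$ with $m>N$ are omitted, and for $i\le\ell$ the factors $x_{i-\ell}$ and $x_{i-\ell+1}$ are omitted. *)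

theory Defs
  imports
    "HOL-Library.Poly_Mapping"
    "HOL-Library.Product_Lexorder"
    "HOL-Computational_Algebra.Fraction_Field"
    "Jordan_Normal_Form.Determinant"
begin

section \<open>Generalized seeds and quasi-homomorphisms\<close>

text \<open>Groups, semifields and seeds live inside an ambient field \<open>'f\<close>.\<close>

definition laurent_monomials :: "'f::field set \<Rightarrow> 'f set" where
  "laurent_monomials G = {\<Prod>g\<in>G. g powi (e g) | e :: 'f \<Rightarrow> int. True}"

inductive_set subtraction_free :: "'f::field set \<Rightarrow> 'f set" for G where
  gen: "g \<in> G \<Longrightarrow> g \<in> subtraction_free G"
| add: "a \<in> subtraction_free G \<Longrightarrow> b \<in> subtraction_free G \<Longrightarrow> a + b \<in> subtraction_free G"
| mult: "a \<in> subtraction_free G \<Longrightarrow> b \<in> subtraction_free G \<Longrightarrow> a * b \<in> subtraction_free G"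
| divide: "a \<in> subtraction_free G \<Longrightarrow> b \<in> subtraction_free G \<Longrightarrow> a / b \<in> subtraction_free G"

definition semifield_hom :: "'f::field set \<Rightarrow> 'g::field set \<Rightarrow> ('f \<Rightarrow> 'g) \<Rightarrow> bool" where
  "semifield_hom F F' \<psi> \<longleftrightarrow> \<psi> ` F \<subseteq> F' \<and>
     (\<forall>a\<in>F. \<forall>b\<in>F. \<psi> (a + b) = \<psi> a + \<psi> b \<and> \<psi> (a * b) = \<psi> a * \<psi> b)"

text \<open>
  Only the values of \<open>clv\<close>, \<open>exm\<close>, \<open>exdeg\<close>, \<open>cof\<close> at indices in \<open>{1..num}\<close> (and \<open>cof S i s\<close> for
  \<open>s \<le> exdeg S i\<close>) are relevant; \<open>exm S j i\<close> is $b_{ji}$ and \<open>cof S i s\<close> is $p_{i;s}$.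
\<close>

record 'f gseed =
  num :: nat
  clv :: "nat \<Rightarrow> 'f"
  exm :: "nat \<Rightarrow> nat \<Rightarrow> int"
  exdeg :: "nat \<Rightarrow> nat"
  cof :: "nat \<Rightarrow> nat \<Rightarrow> 'f"

definition seed_over :: "'f::field set \<Rightarrow> 'f gseed \<Rightarrow> bool" where
  "seed_over P S \<longleftrightarrow> (\<forall>i\<in>{1..num S}. \<forall>s\<le>exdeg S i. cof S i s \<in> P)"

definition seed_Mplus :: "'f::field gseed \<Rightarrow> nat \<Rightarrow> 'f" where
  "seed_Mplus S i = (\<Prod>j=1..num S. clv S j ^ nat (exm S j i))"

definition seed_Mminus :: "'f::field gseed \<Rightarrow> nat \<Rightarrow> 'f" where
  "seed_Mminus S i = (\<Prod>j=1..num S. clv S j ^ nat (- exm S j i))"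

definition yhat :: "'f::field gseed \<Rightarrow> nat \<Rightarrow> nat \<Rightarrow> 'f" where
  "yhat S i s = cof S i s / cof S i 0 * (seed_Mplus S i / seed_Mminus S i) ^ s"

definition seed_equiv :: "'f::field set \<Rightarrow> 'f gseed \<Rightarrow> 'f gseed \<Rightarrow> bool" where
  "seed_equiv P S S' \<longleftrightarrow>
     seed_over P S \<and> seed_over P S' \<and> num S = num S' \<and>
     (\<forall>i\<in>{1..num S}. exdeg S i = exdeg S' i \<and> clv S i / clv S' i \<in> P \<and>
        (\<forall>s\<le>exdeg S i. yhat S i s = yhat S' i s))"

definition map_seed :: "('f \<Rightarrow> 'g) \<Rightarrow> 'f gseed \<Rightarrow> 'g gseed" where
  "map_seed \<psi> S = \<lparr>num = num S, clv = (\<lambda>i. \<psi> (clv S i)), exm = exm S, exdeg = exdeg S,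
     cof = (\<lambda>i s. \<psi> (cof S i s))\<rparr>"

definition seed_semifield :: "'f::field set \<Rightarrow> 'f gseed \<Rightarrow> 'f set" where
  "seed_semifield P S = subtraction_free (clv S ` {1..num S} \<union> P)"

definition quasi_homomorphism ::
    "'f::field set \<Rightarrow> 'f gseed \<Rightarrow> 'g::field set \<Rightarrow> 'g gseed \<Rightarrow> ('f \<Rightarrow> 'g) \<Rightarrow> bool" where
  "quasi_homomorphism P S P' S' \<psi> \<longleftrightarrow>
     seed_over P S \<and> semifield_hom (seed_semifield P S) (seed_semifield P' S') \<psi> \<and>
     \<psi> ` P \<subseteq> P' \<and> seed_equiv P' (map_seed \<psi> S) S'"

section \<open>Rational functions\<close>

text \<open>
  The field of rational functions in indeterminates labelled by pairs of natural numbers.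
  Only finitely many of the indeterminates are used, for given parameters.  Taking integer
  coefficients for the polynomials gives the fraction field $\mathbb{Q}(\ldots)$.
\<close>

type_synonym ratfun = "(((nat \<times> nat) \<Rightarrow>\<^sub>0 nat) \<Rightarrow>\<^sub>0 int) fract"

definition indet :: "nat \<times> nat \<Rightarrow> ratfun" where
  "indet v = Fract (Poly_Mapping.single (Poly_Mapping.single v 1) 1) 1"

definition poly_at :: "('i \<Rightarrow> 'f::field) \<Rightarrow> (('i \<Rightarrow>\<^sub>0 nat) \<Rightarrow>\<^sub>0 int) \<Rightarrow> 'f" where
  "poly_at g p = (\<Sum>m\<in>Poly_Mapping.keys p. of_int (Poly_Mapping.lookup p m) *
     (\<Prod>v\<in>Poly_Mapping.keys m. g v ^ Poly_Mapping.lookup m v))"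

text \<open>
  For a field of characteristic zero, independence over the integers and over the
  rationals is the same.
\<close>

definition alg_independent :: "'i set \<Rightarrow> ('i \<Rightarrow> 'f::field) \<Rightarrow> bool" where
  "alg_independent I g \<longleftrightarrow>
     (\<forall>p. (\<forall>m\<in>Poly_Mapping.keys p. Poly_Mapping.keys m \<subseteq> I) \<and> poly_at g p = 0 \<longrightarrow> p = 0)"

section \<open>The quiver and the algebra $\mathcal{A}_{\mathrm{cyc}}(k,\ell)$\<close>

definition Nkl :: "nat \<Rightarrow> nat \<Rightarrow> nat" where
  "Nkl k l = (k - 1) * (l - 1)"

definition residue :: "nat \<Rightarrow> int \<Rightarrow> nat" where
  "residue l m = nat ((m - 1) mod int l) + 1"

text \<open>
  The number of arrows $j \to i$ in the quiver on \<open>{1..N + l}\<close> with arrows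
  $m+1 \to m \to m+\ell \to m+1$ for \<open>1 \<le> m \<le> N\<close>.
\<close>

definition arrows :: "nat \<Rightarrow> nat \<Rightarrow> nat \<Rightarrow> nat \<Rightarrow> nat" where
  "arrows k l j i = (\<Sum>m=1..Nkl k l.
     of_bool (j = m + 1 \<and> i = m) + of_bool (j = m \<and> i = m + l) + of_bool (j = m + l \<and> i = m + 1))"

definition quiver_matrix :: "nat \<Rightarrow> nat \<Rightarrow> nat \<Rightarrow> nat \<Rightarrow> int" where
  "quiver_matrix k l j i = int (arrows k l j i) - int (arrows k l i j)"

lemma arrows_eq:
  "arrows k l j i = of_bool (1 \<le> i \<and> i \<le> Nkl k l \<and> j = i + 1) +
     of_bool (1 \<le> j \<and> j \<le> Nkl k l \<and> i = j + l) +
     of_bool (2 \<le> i \<and> i \<le> Nkl k l + 1 \<and> j + 1 = i + l)"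
proof -
  have 1: "(\<Sum>m=1..N. of_bool (j = m + 1 \<and> i = m)) = (of_bool (1 \<le> i \<and> i \<le> N \<and> j = i + 1) :: nat)"
    for N
  proof -
    have "(\<Sum>m=1..N. of_bool (j = m + 1 \<and> i = m)) = (\<Sum>m=1..N. if m = i then of_bool (j = i + 1) else 0 :: nat)"
      by (rule sum.cong) auto
    also have "\<dots> = of_bool (1 \<le> i \<and> i \<le> N \<and> j = i + 1)"
      by (subst sum.delta) auto
    finally show ?thesis .
  qed
  have 2: "(\<Sum>m=1..N. of_bool (j = m \<and> i = m + l)) = (of_bool (1 \<le> j \<and> j \<le> N \<and> i = j + l) :: nat)"
    for N
  proof -
    have "(\<Sum>m=1..N. of_bool (j = m \<and> i = m + l)) = (\<Sum>m=1..N. if m = j then of_bool (i = j + l) else 0 :: nat)"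
      by (rule sum.cong) auto
    also have "\<dots> = of_bool (1 \<le> j \<and> j \<le> N \<and> i = j + l)"
      by (subst sum.delta) auto
    finally show ?thesis .
  qed
  have 3: "(\<Sum>m=1..N. of_bool (j = m + l \<and> i = m + 1)) =
      (of_bool (2 \<le> i \<and> i \<le> N + 1 \<and> j + 1 = i + l) :: nat)" for N
  proof -
    have "(\<Sum>m=1..N. of_bool (j = m + l \<and> i = m + 1)) =
        (\<Sum>m=1..N. if m = i - 1 then of_bool (1 \<le> i \<and> j + 1 = i + l) else 0 :: nat)"
      by (rule sum.cong) auto
    also have "\<dots> = of_bool (2 \<le> i \<and> i \<le> N + 1 \<and> j + 1 = i + l)"
      by (subst sum.delta) auto
    finally show ?thesis .
  qed
  show ?thesis
    unfolding arrows_def by (simp only: sum.distrib 1 2 3)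
qed

lemma prod_power_of_bool:
  fixes f :: "nat \<Rightarrow> 'f::field"
  shows "(\<Prod>j=1..n. f j ^ of_bool (j = c)) = (if 1 \<le> c \<and> c \<le> n then f c else 1)"
proof -
  have "(\<Prod>j=1..n. f j ^ of_bool (j = c)) = (\<Prod>j=1..n. if j = c then f c else 1)"
    by (rule prod.cong) auto
  then show ?thesis by (simp add: prod.delta)
qed

lemma quiver_matrix_parts:
  assumes "3 \<le> l" "1 \<le> i" "i \<le> Nkl k l" "1 \<le> j"
  shows "nat (quiver_matrix k l j i) = of_bool (j = i + 1) +
      of_bool (j = (if i \<le> l then 0 else i - l)) + of_bool (j = (if i = 1 then 0 else i + l - 1))"
      (is "_ = of_bool ?A + of_bool ?B + of_bool ?C")
    and "nat (- quiver_matrix k l j i) = of_bool (j = i + l) + of_bool (j = i - 1) +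
      of_bool (j = (if i \<le> l then 0 else i - l + 1))"
      (is "_ = of_bool ?D + of_bool ?E + of_bool ?F")
proof -
  have 1: "(1 \<le> i \<and> i \<le> Nkl k l \<and> j = i + 1) = ?A" using assms by linarith
  have 2: "(1 \<le> j \<and> j \<le> Nkl k l \<and> i = j + l) = ?B" using assms by (cases "i \<le> l"; simp; linarith)
  have 3: "(2 \<le> i \<and> i \<le> Nkl k l + 1 \<and> j + 1 = i + l) = ?C" using assms by (cases "i = 1"; simp; linarith)
  have 4: "(1 \<le> j \<and> j \<le> Nkl k l \<and> i = j + 1) = ?E" using assms by linarith
  have 5: "(1 \<le> i \<and> i \<le> Nkl k l \<and> j = i + l) = ?D" using assms by linarith
  have 6: "(2 \<le> j \<and> j \<le> Nkl k l + 1 \<and> i + 1 = j + l) = ?F" using assms by (cases "i \<le> l"; simp; linarith)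
  have q: "quiver_matrix k l j i = int (of_bool ?A + of_bool ?B + of_bool ?C) -
      int (of_bool ?E + of_bool ?D + of_bool ?F)"
    unfolding quiver_matrix_def arrows_eq[of k l j i] arrows_eq[of k l i j] 1 2 3 4 5 6 ..
  have disj: "of_bool ?A + of_bool ?B + of_bool ?C = (0 :: nat) \<or>
      of_bool ?D + of_bool ?E + of_bool ?F = (0 :: nat)"
  proof (cases "?A \<or> ?B \<or> ?C")
    case True
    then have "\<not> ?D \<and> \<not> ?E \<and> \<not> ?F"
      using assms by (auto split: if_splits)
    then show ?thesis by simp
  qed simp
  show "nat (quiver_matrix k l j i) = of_bool ?A + of_bool ?B + of_bool ?C"
    and "nat (- quiver_matrix k l j i) = of_bool ?D + of_bool ?E + of_bool ?F"
    using q disj by linarith+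
qed

lemma quiver_prod_plus:
  fixes f :: "nat \<Rightarrow> 'f::field"
  assumes "3 \<le> l" "1 \<le> i" "i \<le> Nkl k l" "Nkl k l \<le> n"
  shows "(\<Prod>j=1..n. f j ^ nat (quiver_matrix k l j i)) =
    (if i + 1 \<le> n then f (i + 1) else 1) * (if i \<le> l then 1 else f (i - l)) *
    (if i = 1 then 1 else if i + l - 1 \<le> n then f (i + l - 1) else 1)"
proof -
  have "(\<Prod>j=1..n. f j ^ nat (quiver_matrix k l j i)) =
    (\<Prod>j=1..n. f j ^ of_bool (j = i + 1) * f j ^ of_bool (j = (if i \<le> l then 0 else i - l)) *
       f j ^ of_bool (j = (if i = 1 then 0 else i + l - 1)))"
    using assms by (intro prod.cong refl) (simp add: quiver_matrix_parts power_add del: of_bool_eq)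
  also have "\<dots> = (if i + 1 \<le> n then f (i + 1) else 1) * (if i \<le> l then 1 else f (i - l)) *
    (if i = 1 then 1 else if i + l - 1 \<le> n then f (i + l - 1) else 1)"
    unfolding prod.distrib prod_power_of_bool using assms by auto
  finally show ?thesis .
qed

lemma quiver_prod_minus:
  fixes f :: "nat \<Rightarrow> 'f::field"
  assumes "3 \<le> l" "1 \<le> i" "i \<le> Nkl k l" "Nkl k l \<le> n"
  shows "(\<Prod>j=1..n. f j ^ nat (- quiver_matrix k l j i)) =
    (if i + l \<le> n then f (i + l) else 1) * (if i = 1 then 1 else f (i - 1)) *
    (if i \<le> l then 1 else f (i - l + 1))"
proof -
  have "(\<Prod>j=1..n. f j ^ nat (- quiver_matrix k l j i)) =
    (\<Prod>j=1..n. f j ^ of_bool (j = i + l) * f j ^ of_bool (j = i - 1) *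
       f j ^ of_bool (j = (if i \<le> l then 0 else i - l + 1)))"
    using assms by (intro prod.cong refl) (simp add: quiver_matrix_parts power_add del: of_bool_eq)
  also have "\<dots> = (if i + l \<le> n then f (i + l) else 1) * (if i = 1 then 1 else f (i - 1)) *
    (if i \<le> l then 1 else f (i - l + 1))"
    unfolding prod.distrib prod_power_of_bool using assms by auto
  finally show ?thesis .
qed

definition seed_degree :: "nat \<Rightarrow> nat \<Rightarrow> nat" where
  "seed_degree k i = (if i = 1 then k else 1)"

definition cyc_x :: "nat \<Rightarrow> ratfun" where
  "cyc_x i = indet (0, i)"

text \<open>The identification \<open>z s = z (k - s)\<close> is built into the choice of the indeterminate.\<close>

definition cyc_z :: "nat \<Rightarrow> nat \<Rightarrow> ratfun" where
  "cyc_z k s = (if s = 0 \<or> s = k then 1 else indet (1, min s (k - s)))"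

definition cyc_P :: "nat \<Rightarrow> nat \<Rightarrow> ratfun set" where
  "cyc_P k l = laurent_monomials (cyc_x ` {Nkl k l + 1..Nkl k l + l} \<union> cyc_z k ` {1..k - 1})"

text \<open>
  The frozen part of the extended exchange monomials is absorbed into the coefficients:
  this is the coefficient of $(M_i^+)^s (M_i^-)^{d_i-s}$, with $M_i^\pm$ monomials in the mutable
  variables.
\<close>

definition cyc_seed :: "nat \<Rightarrow> nat \<Rightarrow> ratfun gseed" where
  "cyc_seed k l = \<lparr>num = Nkl k l, clv = cyc_x, exm = quiver_matrix k l, exdeg = seed_degree k,
     cof = (\<lambda>i s. (if i = 1 then cyc_z k s else 1) *
       (\<Prod>j=Nkl k l + 1..Nkl k l + l. cyc_x j ^ nat (quiver_matrix k l j i)) ^ s *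
       (\<Prod>j=Nkl k l + 1..Nkl k l + l. cyc_x j ^ nat (- quiver_matrix k l j i))
         ^ (seed_degree k i - s))\<rparr>"

definition cyc_yhat :: "nat \<Rightarrow> nat \<Rightarrow> nat \<Rightarrow> nat \<Rightarrow> ratfun" where
  "cyc_yhat k l i s =
    (if i = 1 then cyc_z k s * (cyc_x 2 / cyc_x (l + 1)) ^ s
     else (cyc_x (i + 1) * (if i \<le> l then 1 else cyc_x (i - l)) * cyc_x (i + l - 1)) /
          (cyc_x (i + l) * cyc_x (i - 1) * (if i \<le> l then 1 else cyc_x (i - l + 1))))"

lemma indet_nonzero: "indet v \<noteq> 0"
proof -
  have "Poly_Mapping.single (Poly_Mapping.single v (1::nat)) (1::int) \<noteq> 0"
    by (metis lookup_single_eq lookup_zero zero_neq_one)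
  then show ?thesis
    by (simp add: indet_def Zero_fract_def eq_fract)
qed

lemma Nkl_bounds:
  assumes "2 \<le> k" "k < l"
  shows "2 \<le> Nkl k l" "k = 2 \<Longrightarrow> Nkl k l = l - 1" "3 \<le> k \<Longrightarrow> l + 1 \<le> Nkl k l"
proof -
  have le: "a * (l - 1) \<le> Nkl k l" if "a \<le> k - 1" for a
    unfolding Nkl_def using that by (rule mult_le_mono1)
  show "2 \<le> Nkl k l" using le[of 1] assms by (simp add: le_diff_conv2)
  show "Nkl k l = l - 1" if "k = 2" using that by (simp add: Nkl_def)
  show "l + 1 \<le> Nkl k l" if "3 \<le> k"
  proof -
    have "2 * (l - 1) \<le> Nkl k l" by (rule le) (use that in linarith)
    then show ?thesis using that assms by linarith
  qed
qed

lemma yhat_cyc_seed: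
  assumes "2 \<le> k" "k < l" "1 \<le> i" "i \<le> Nkl k l" "1 \<le> s" "s \<le> seed_degree k i"
  shows "yhat (cyc_seed k l) i s = cyc_yhat k l i s"
proof -
  define N where "N = Nkl k l"
  define Fp where "Fp = (\<Prod>j=N + 1..N + l. cyc_x j ^ nat (quiver_matrix k l j i))"
  define Fm where "Fm = (\<Prod>j=N + 1..N + l. cyc_x j ^ nat (- quiver_matrix k l j i))"
  define Mp where "Mp = (\<Prod>j=1..N. cyc_x j ^ nat (quiver_matrix k l j i))"
  define Mm where "Mm = (\<Prod>j=1..N. cyc_x j ^ nat (- quiver_matrix k l j i))"
  have x0: "cyc_x j \<noteq> 0" for j by (simp add: cyc_x_def indet_nonzero)
  have Fm0: "Fm \<noteq> 0" by (simp add: Fm_def x0)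
  have un: "{1..N + l} = {1..N} \<union> {N + 1..N + l}" by auto
  have P: "Mp * Fp = (\<Prod>j=1..N + l. cyc_x j ^ nat (quiver_matrix k l j i))"
    unfolding Mp_def Fp_def un by (rule prod.union_disjoint[symmetric]) auto
  have Q: "Mm * Fm = (\<Prod>j=1..N + l. cyc_x j ^ nat (- quiver_matrix k l j i))"
    unfolding Mm_def Fm_def un by (rule prod.union_disjoint[symmetric]) auto
  have P': "Mp * Fp = cyc_x (i + 1) * (if i \<le> l then 1 else cyc_x (i - l)) *
      (if i = 1 then 1 else cyc_x (i + l - 1))"
    unfolding P using assms by (subst quiver_prod_plus) (auto simp: N_def)
  have Q': "Mm * Fm = cyc_x (i + l) * (if i = 1 then 1 else cyc_x (i - 1)) *
      (if i \<le> l then 1 else cyc_x (i - l + 1))"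
    unfolding Q using assms by (subst quiver_prod_minus) (auto simp: N_def)
  have y: "yhat (cyc_seed k l) i s =
      ((if i = 1 then cyc_z k s else 1) * Fp ^ s * Fm ^ (seed_degree k i - s)) /
      ((if i = 1 then cyc_z k 0 else 1) * Fm ^ seed_degree k i) * (Mp / Mm) ^ s"
    by (simp add: yhat_def cyc_seed_def seed_Mplus_def seed_Mminus_def N_def Fp_def Fm_def Mp_def Mm_def)
  have "Fm ^ seed_degree k i = Fm ^ (seed_degree k i - s) * Fm ^ s"
    using assms by (simp flip: power_add)
  then have "yhat (cyc_seed k l) i s = (if i = 1 then cyc_z k s else 1) * ((Mp * Fp) / (Mm * Fm)) ^ s"
    unfolding y using Fm0 by (simp add: cyc_z_def[of k 0] power_divide power_mult_distrib field_simps)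
  also have "\<dots> = cyc_yhat k l i s"
    using assms unfolding P' Q' by (auto simp: cyc_yhat_def seed_degree_def numeral_2_eq_2)
  finally show ?thesis .
qed

section \<open>The algebra $\mathcal{A}_{\mathrm{GSV}}(k,\ell)$\<close>

text \<open>
  The generic element of $\mathrm{Band}(k,\ell)$: the indeterminate \<open>indet (i, d)\<close>, for
  \<open>1 \<le> i \<le> l\<close> and \<open>d \<le> k\<close>, is the coordinate function $M_{i,i+d}$.
\<close>

definition band :: "nat \<Rightarrow> nat \<Rightarrow> int \<Rightarrow> int \<Rightarrow> ratfun" where
  "band k l i j = (if 0 \<le> j - i \<and> j - i \<le> int k then indet (residue l i, nat (j - i)) else 0)"

definition gsv_A :: "nat \<Rightarrow> nat \<Rightarrow> nat \<Rightarrow> nat \<Rightarrow> ratfun" where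
  "gsv_A k l i j = (if j \<le> l - k then 0 else band k l (int i) (int (j - (l - k))))"

definition gsv_B :: "nat \<Rightarrow> nat \<Rightarrow> nat \<Rightarrow> nat \<Rightarrow> ratfun" where
  "gsv_B k l i j = band k l (int i) (int (k + j))"

text \<open>The polynomial $\det(tB+A)$ in $t$; matrix indices of \<open>mat\<close> start at 0.\<close>

definition gsv_char :: "nat \<Rightarrow> nat \<Rightarrow> ratfun poly" where
  "gsv_char k l = det (mat l l (\<lambda>(i, j). [:gsv_A k l (i + 1) (j + 1), gsv_B k l (i + 1) (j + 1):]))"

definition gsv_c :: "nat \<Rightarrow> nat \<Rightarrow> nat \<Rightarrow> ratfun" where
  "gsv_c k l s = (-1) ^ (s * (l - s)) * coeff (gsv_char k l) (l - s)"

definition gsv_rows :: "nat \<Rightarrow> nat \<Rightarrow> nat \<Rightarrow> nat list" where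
  "gsv_rows k l n =
    (let R = sorted_list_of_set {j \<in> {1..(k - 1) * l}. j mod l \<noteq> 1}
     in drop (length R - n) R)"

definition gsv_x :: "nat \<Rightarrow> nat \<Rightarrow> nat \<Rightarrow> ratfun" where
  "gsv_x k l i =
    (let rs = gsv_rows k l (Nkl k l - i + 1); cs = [k + i..<(k - 1) * l + 2]
     in det (mat (length rs) (length cs) (\<lambda>(a, b). band k l (int (rs ! a)) (int (cs ! b)))))"

definition gsv_P :: "nat \<Rightarrow> nat \<Rightarrow> ratfun set" where
  "gsv_P k l = laurent_monomials
     ((\<lambda>i. band k l (int i) (int i)) ` {1..l} \<union>
      (\<lambda>i. band k l (int i) (int (i + k))) ` {1..l} \<union>
      gsv_c k l ` {1..k - 1})"

definition gsv_p1 :: "nat \<Rightarrow> nat \<Rightarrow> nat \<Rightarrow> ratfun" where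
  "gsv_p1 k l s =
    (if s = 0 then (\<Prod>i=1..l. band k l (int i) (int i)) *
                   (\<Prod>i=2..l. band k l (int i) (int (i + k)) ^ (k - 1))
     else if s < k then gsv_c k l s * (\<Prod>i=2..l. band k l (int i) (int (i + k)) ^ (k - 1 - s))
     else band k l 1 (int (1 + k)))"

text \<open>The factor $M_{i,i+k}^{\epsilon_i} M_{i+k-1,i+k-1}^{\delta_i}$.\<close>

definition gsv_frozen :: "nat \<Rightarrow> nat \<Rightarrow> nat \<Rightarrow> ratfun" where
  "gsv_frozen k l i =
    (if 2 \<le> i \<and> i \<le> l then band k l (int i) (int (i + k)) else 1) *
    (if Nkl k l + 2 \<le> i + l \<and> i \<le> Nkl k l
     then band k l (int (i + k - 1)) (int (i + k - 1)) else 1)"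

definition gsv_yhat :: "nat \<Rightarrow> nat \<Rightarrow> nat \<Rightarrow> nat \<Rightarrow> ratfun" where
  "gsv_yhat k l i s =
    (let X = (\<lambda>m. if m > Nkl k l then 1 else gsv_x k l m)
     in if i = 1
        then gsv_p1 k l s / gsv_p1 k l 0 *
             (gsv_x k l 2 / (if k = 2 then 1 / band k l 2 2 else gsv_x k l (l + 1))) ^ s
        else (X (i + 1) * (if i \<le> l then 1 else X (i - l)) * X (i + l - 1)) /
             (X (i + l) * X (i - 1) * (if i \<le> l then 1 else X (i - l + 1))) *
             gsv_frozen k l i)"

text \<open>
  The exchange matrix is the mutable part of the quiver above, and the coefficients are
  normalized by \<open>cof _ i 0 = 1\<close> for \<open>i \<ge> 2\<close>; rescaling all \<open>cof _ i s\<close> with \<open>i\<close> fixed by a common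
  element changes neither \<open>yhat\<close> nor the equivalence class of the seed.  For \<open>k = 2\<close> the
  convention $x_{\ell+1} = 1/M_{2,2}$ becomes a factor of the coefficients.  Lemma \<open>yhat_gsv_seed\<close>
  shows that this seed has the prescribed \<open>yhat\<close>.
\<close>

definition gsv_seed :: "nat \<Rightarrow> nat \<Rightarrow> ratfun gseed" where
  "gsv_seed k l = \<lparr>num = Nkl k l, clv = gsv_x k l, exm = quiver_matrix k l, exdeg = seed_degree k,
     cof = (\<lambda>i s. if i = 1 then gsv_p1 k l s * (if k = 2 then band k l 2 2 ^ s else 1)
                  else gsv_frozen k l i ^ s)\<rparr>"

lemma yhat_gsv_seed:
  assumes "2 \<le> k" "k < l" "1 \<le> i" "i \<le> Nkl k l" "1 \<le> s" "s \<le> seed_degree k i"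
  shows "yhat (gsv_seed k l) i s = gsv_yhat k l i s"
proof -
  note N = Nkl_bounds[OF assms(1,2)]
  have p: "seed_Mplus (gsv_seed k l) i =
      (if i + 1 \<le> Nkl k l then gsv_x k l (i + 1) else 1) * (if i \<le> l then 1 else gsv_x k l (i - l)) *
      (if i = 1 then 1 else if i + l - 1 \<le> Nkl k l then gsv_x k l (i + l - 1) else 1)"
    using assms quiver_prod_plus[of l i k "Nkl k l" "gsv_x k l"]
    unfolding seed_Mplus_def by (simp add: gsv_seed_def)
  have m: "seed_Mminus (gsv_seed k l) i =
      (if i + l \<le> Nkl k l then gsv_x k l (i + l) else 1) * (if i = 1 then 1 else gsv_x k l (i - 1)) *
      (if i \<le> l then 1 else gsv_x k l (i - l + 1))"
    using assms quiver_prod_minus[of l i k "Nkl k l" "gsv_x k l"]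
    unfolding seed_Mminus_def by (simp add: gsv_seed_def)
  define Mp where "Mp = seed_Mplus (gsv_seed k l) i"
  define Mm where "Mm = seed_Mminus (gsv_seed k l) i"
  have y: "yhat (gsv_seed k l) i s = cof (gsv_seed k l) i s / cof (gsv_seed k l) i 0 * (Mp / Mm) ^ s"
    by (simp add: yhat_def Mp_def Mm_def)
  show ?thesis
  proof (cases "i = 1")
    case i: True
    show ?thesis
    proof (cases "k = 2")
      case True
      have "Mp = gsv_x k l 2" "Mm = 1"
        unfolding Mp_def Mm_def p m using True i N assms by (simp_all add: numeral_2_eq_2)
      then show ?thesis
        unfolding y using i True by (simp add: gsv_seed_def gsv_yhat_def power_mult_distrib)
    next
      case False
      have "Mp = gsv_x k l 2" "Mm = gsv_x k l (l + 1)"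
        unfolding Mp_def Mm_def p m using False i N assms by (simp_all add: numeral_2_eq_2)
      then show ?thesis
        unfolding y using i False by (simp add: gsv_seed_def gsv_yhat_def)
    qed
  next
    case False
    then have s: "s = 1" using assms by (simp add: seed_degree_def)
    have X: "\<And>m. (if m > Nkl k l then 1 else gsv_x k l m) = (if m \<le> Nkl k l then gsv_x k l m else 1)"
      by simp
    have "i - 1 \<le> Nkl k l" "i - l \<le> Nkl k l" using assms by auto
    moreover have "\<not> i \<le> l \<Longrightarrow> i - l + 1 \<le> Nkl k l" using assms by linarith
    ultimately show ?thesis
      unfolding y Mp_def Mm_def p m gsv_yhat_def Let_def X using False
      by (cases "i \<le> l") (simp_all add: s gsv_seed_def)
  qed
qed

text \<open>
  The functions $x_i$, $M_{i,i}$, $M_{i,i+k}$, $\tilde c_s$ on $\mathrm{Band}(k,\ell)$ as one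
  indexed family.
\<close>

definition gsv_index :: "nat \<Rightarrow> nat \<Rightarrow> (nat \<times> nat) set" where
  "gsv_index k l =
     {0} \<times> {1..Nkl k l} \<union> {1} \<times> {1..l} \<union> {2} \<times> {1..l} \<union> {3} \<times> {1..k - 1}"

definition gsv_family :: "nat \<Rightarrow> nat \<Rightarrow> nat \<times> nat \<Rightarrow> ratfun" where
  "gsv_family k l = (\<lambda>(a, i).
     if a = 0 then gsv_x k l i
     else if a = 1 then band k l (int i) (int i)
     else if a = 2 then band k l (int i) (int (i + k))
     else gsv_c k l i)"

section \<open>The homomorphism\<close>

definition is_psi_star :: "nat \<Rightarrow> nat \<Rightarrow> (ratfun \<Rightarrow> ratfun) \<Rightarrow> bool" where
  "is_psi_star k l \<psi> \<longleftrightarrow>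
     semifield_hom (seed_semifield (gsv_P k l) (gsv_seed k l))
                   (seed_semifield (cyc_P k l) (cyc_seed k l)) \<psi> \<and>
     (\<forall>i\<in>{1..Nkl k l}. \<psi> (gsv_x k l i) =
        cyc_x i * (\<Prod>b=i..<Nkl k l. cyc_x (Nkl k l + residue l (int (b + k))))) \<and>
     (\<forall>i::int. \<psi> (band k l i i) = cyc_x (Nkl k l + residue l (i - 1)) \<and>
        \<psi> (band k l (i - int k - 1) (i - 1)) = cyc_x (Nkl k l + residue l (i - 1))) \<and>
     (\<forall>s\<in>{1..k - 1}. \<psi> (gsv_c k l s) = cyc_z k s * (\<Prod>i=1..l. cyc_x (Nkl k l + i)))"

end

theory Submission
  imports Defs
begin

text \<open>
  Write $f_m = \overline x_{N + (m \bmod \ell)}$ and $y_i = \psi^*(x_i)$, with $y_m = 1$ for $m > N$.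
  Since $N + k - 1 = (k-1)\ell$, the frozen variable $\overline x_m$ with $N < m \le N + \ell$ is
  $f_{m+k-1}$, so that $y_m / y_{m+1} = f_{m+k}\, \overline x_m / \overline x_{m+1}$ holds for all
  $m \le N$, including $m = N$.  Substituting these ratios into $\hat y_{i;1}$, the factors $f$ cancel in the
  generic case, and near both ends of the quiver the frozen factors $M_{i,i+k}$ and $M_{i+k-1,i+k-1}$
  supply exactly what is missing.  For $i = 1$ the ratios telescope to
  $Q = f_{k+2} \cdots f_{k+\ell}$, and $\psi^*(p_{1;s}/p_{1;0}) = z_s Q^{-s}$.

  A map on subtraction-free expressions that respects sums and products also respects quotients, because
  $0$ is not subtraction-free in independent indeterminates; hence it is determined by its values
  on generators.  It exists with arbitrary values on algebraically independent generators, since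
  every subtraction-free expression is a quotient of polynomials with positive coefficients.
\<close>

section \<open>Semifields in a field\<close>

text \<open>Division is total in the ambient field, so \<open>0 \<notin> P\<close> is demanded
  explicitly; closure under quotients together with \<open>1 \<in> P\<close> then supplies
  inverses.\<close>

definition mult_subgroup :: "'f::field set \<Rightarrow> bool" where
  "mult_subgroup P \<longleftrightarrow> 1 \<in> P \<and> 0 \<notin> P \<and> (\<forall>a\<in>P. \<forall>b\<in>P. a * b \<in> P \<and> a / b \<in> P)"

definition subsemifield :: "'f::field set \<Rightarrow> bool" where
  "subsemifield F \<longleftrightarrow> mult_subgroup F \<and> (\<forall>a\<in>F. \<forall>b\<in>F. a + b \<in> F)"

lemma mult_subgroup_prod:
  assumes "mult_subgroup P" "\<And>i. i \<in> A \<Longrightarrow> f i \<in> P"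
  shows "prod f A \<in> P"
  using assms(2)
proof (induction A rule: infinite_finite_induct)
  case (insert x A)
  then show ?case using assms(1) by (simp add: mult_subgroup_def)
qed (use assms(1) in \<open>simp_all add: mult_subgroup_def\<close>)

lemma mult_subgroup_power:
  assumes "mult_subgroup P" "a \<in> P"
  shows "a ^ n \<in> P"
  using mult_subgroup_prod[OF assms(1), of "{..<n}" "\<lambda>_. a"] assms(2) by simp

lemma mult_subgroup_power_int:
  assumes "mult_subgroup P" "a \<in> P"
  shows "a powi n \<in> P"
proof -
  have "1 / a ^ nat (- n) \<in> P"
    using mult_subgroup_power[OF assms] assms(1) by (simp add: mult_subgroup_def)
  then show ?thesis
    using mult_subgroup_power[OF assms] by (simp add: power_int_def power_inverse field_simps)
qed

lemma laurent_monomials_subset: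
  assumes "mult_subgroup P" "G \<subseteq> P"
  shows "laurent_monomials G \<subseteq> P"
  using assms by (auto simp: laurent_monomials_def intro!: mult_subgroup_prod mult_subgroup_power_int)

lemma mult_subgroup_laurent_monomials:
  assumes "0 \<notin> G"
  shows "mult_subgroup (laurent_monomials G)"
proof -
  have nz: "g \<noteq> 0" if "g \<in> G" for g using that assms by auto
  have m: "(\<Prod>g\<in>G. g powi e g) * (\<Prod>g\<in>G. g powi e' g) = (\<Prod>g\<in>G. g powi (e g + e' g))" for e e'
    by (simp add: prod.distrib[symmetric] power_int_add nz)
  have d: "(\<Prod>g\<in>G. g powi e g) / (\<Prod>g\<in>G. g powi e' g) = (\<Prod>g\<in>G. g powi (e g - e' g))" for e e'
    by (simp add: prod_dividef[symmetric] power_int_diff nz)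
  \<comment> \<open>Over an infinite \<open>G\<close> the product is 1 by convention, hence nonzero
    in that case as well.\<close>
  have z: "(\<Prod>g\<in>G. g powi e g) \<noteq> 0" for e
    by (cases "finite G") (simp_all add: nz)
  have mem: "(\<Prod>g\<in>G. g powi e g) \<in> laurent_monomials G" for e
    unfolding laurent_monomials_def by blast
  have "a * b \<in> laurent_monomials G \<and> a / b \<in> laurent_monomials G"
    if ab: "a \<in> laurent_monomials G" "b \<in> laurent_monomials G" for a b
  proof -
    obtain e e' where "a = (\<Prod>g\<in>G. g powi e g)" "b = (\<Prod>g\<in>G. g powi e' g)"
      using ab unfolding laurent_monomials_def by blast
    then show ?thesis by (simp only: m d mem simp_thms)
  qed
  moreover have "0 \<notin> laurent_monomials G"
    using z by (force simp: laurent_monomials_def)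
  moreover have "1 \<in> laurent_monomials G"
    using mem[of "\<lambda>_. 0"] by simp
  ultimately show ?thesis
    unfolding mult_subgroup_def by blast
qed

text \<open>The exponent vector is the indicator of \<open>x\<close>. Finiteness makes the product
  genuine, since a product over an infinite set is 1.\<close>

lemma subset_laurent_monomials:
  assumes "finite G"
  shows "G \<subseteq> laurent_monomials G"
proof
  fix x assume "x \<in> G"
  then have "x = (\<Prod>g\<in>G. g powi (if g = x then 1 else 0))"
    using assms by (simp add: if_distrib[of "power_int _"] cong: if_cong)
  then show "x \<in> laurent_monomials G"
    unfolding laurent_monomials_def by (intro CollectI exI[of _ "\<lambda>g. if g = x then 1 else 0"]) simp
qed

lemma subtraction_free_subset:
  assumes "subsemifield F" "G \<subseteq> F"
  shows "subtraction_free G \<subseteq> F"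
proof
  fix x assume "x \<in> subtraction_free G"
  then show "x \<in> F"
    by induction (use assms in \<open>auto simp: subsemifield_def mult_subgroup_def\<close>)
qed

text \<open>Once 0 is excluded, a single generator yields 1 as \<open>g / g\<close>; the other
  closure properties are built into the inductive definition.\<close>

lemma subsemifield_subtraction_free:
  assumes "0 \<notin> subtraction_free G" "G \<noteq> {}"
  shows "subsemifield (subtraction_free G)"
proof -
  obtain g where g: "g \<in> subtraction_free G" using assms(2) by (auto intro: subtraction_free.gen)
  have "g / g \<in> subtraction_free G" by (intro subtraction_free.divide g)
  moreover have "g \<noteq> 0" using g assms(1) by auto
  ultimately have "1 \<in> subtraction_free G" by simp
  then show ?thesis
    using assms(1) unfolding subsemifield_def mult_subgroup_def
    by (auto intro: subtraction_free.intros)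
qed

section \<open>Homomorphisms between subsemifields\<close>

locale subsemifield_hom =
  fixes F :: "'f::field set" and F' :: "'g::field set" and \<psi>
  assumes dom: "subsemifield F" and cod: "subsemifield F'" and hom: "semifield_hom F F' \<psi>"
begin

lemma group: "mult_subgroup F"
  using dom by (simp add: subsemifield_def)

lemma in_cod: "a \<in> F \<Longrightarrow> \<psi> a \<in> F'"
  using hom by (auto simp: semifield_hom_def)

lemma nonzero: "a \<in> F \<Longrightarrow> \<psi> a \<noteq> 0"
  using in_cod cod by (metis mult_subgroup_def subsemifield_def)

lemma mult: "a \<in> F \<Longrightarrow> b \<in> F \<Longrightarrow> \<psi> (a * b) = \<psi> a * \<psi> b"
  using hom by (auto simp: semifield_hom_def)

lemma one_F: "1 \<in> F"
  using group by (simp add: mult_subgroup_def)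

text \<open>The image of 1 is idempotent, and it is nonzero because it lies in
  \<open>F'\<close>.\<close>

lemma one: "\<psi> 1 = 1"
  using mult[OF one_F one_F] nonzero[OF one_F] by simp

text \<open>Multiplicativity applied to \<open>a / b * b = a\<close> gives the quotient rule,
  because the image of \<open>b\<close> is nonzero and can be cancelled.\<close>

lemma divide: "a \<in> F \<Longrightarrow> b \<in> F \<Longrightarrow> \<psi> (a / b) = \<psi> a / \<psi> b"
proof -
  assume ab: "a \<in> F" "b \<in> F"
  then have "\<psi> (a / b * b) = \<psi> (a / b) * \<psi> b"
    using group by (intro mult) (auto simp: mult_subgroup_def)
  moreover have "b \<noteq> 0" using ab group by (auto simp: mult_subgroup_def)
  ultimately show ?thesis using nonzero[OF ab(2)] by (simp add: field_simps)
qed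

lemma prod: "(\<And>i. i \<in> A \<Longrightarrow> f i \<in> F) \<Longrightarrow> \<psi> (prod f A) = (\<Prod>i\<in>A. \<psi> (f i))"
  by (induction A rule: infinite_finite_induct) (simp_all add: one mult mult_subgroup_prod[OF group])

lemma power: "a \<in> F \<Longrightarrow> \<psi> (a ^ n) = \<psi> a ^ n"
  using prod[of "{..<n}" "\<lambda>_. a"] by simp

lemma power_int: "a \<in> F \<Longrightarrow> \<psi> (a powi n) = \<psi> a powi n"
proof -
  assume a: "a \<in> F"
  from one_F have "\<psi> (1 / a ^ nat (- n)) = 1 / \<psi> a ^ nat (- n)"
    using mult_subgroup_power[OF group a] by (simp only: divide one power[OF a])
  then show ?thesis
    using power[OF a] by (simp add: power_int_def power_inverse field_simps)
qed

lemma laurent_monomials_image: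
  assumes "G \<subseteq> F" "mult_subgroup P" "\<psi> ` G \<subseteq> P"
  shows "\<psi> ` laurent_monomials G \<subseteq> P"
proof -
  have "\<psi> (\<Prod>g\<in>G. g powi e g) \<in> P" for e
    using assms mult_subgroup_power_int[OF group]
    by (subst prod) (auto simp: power_int subset_iff intro!: mult_subgroup_prod mult_subgroup_power_int)
  then show ?thesis
    by (auto simp: laurent_monomials_def)
qed

end

text \<open>A 0 in the domain would satisfy \<psi> 0 = \<psi> 0 + \<psi> 0, so its image would be 0,
  which \<open>F'\<close> excludes. Thus the homomorphism itself certifies that no subtraction-free
  expression in \<open>G\<close> vanishes.\<close>

lemma subtraction_free_hom_dom:
  assumes "semifield_hom (subtraction_free G) F' \<psi>" "subsemifield F'" "G \<noteq> {}"
  shows "subsemifield (subtraction_free G)"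
proof (rule subsemifield_subtraction_free[OF _ assms(3)], rule notI)
  assume z: "0 \<in> subtraction_free G"
  then have "\<psi> (0 + 0) = \<psi> 0 + \<psi> 0" "\<psi> 0 \<in> F'"
    using assms(1) unfolding semifield_hom_def by blast+
  then have "\<psi> 0 = 0" "\<psi> 0 \<in> F'"
    by (metis add_0 add_cancel_right_right)+
  then show False
    using assms(2) by (simp add: subsemifield_def mult_subgroup_def)
qed

lemma subsemifield_hom_eqI:
  assumes "subsemifield_hom (subtraction_free G) F' \<psi>" "subsemifield_hom (subtraction_free G) F' \<psi>'"
    and "\<And>g. g \<in> G \<Longrightarrow> \<psi> g = \<psi>' g" "x \<in> subtraction_free G"
  shows "\<psi> x = \<psi>' x"
  using assms(4)
proof induction
  case (add a b)
  then show ?case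
    using subsemifield_hom.hom[OF assms(1)] subsemifield_hom.hom[OF assms(2)]
    by (simp add: semifield_hom_def)
qed (simp_all add: assms(3) subsemifield_hom.mult[OF assms(1)] subsemifield_hom.mult[OF assms(2)]
      subsemifield_hom.divide[OF assms(1)] subsemifield_hom.divide[OF assms(2)])

section \<open>Positive polynomials\<close>

text \<open>These are the nonzero polynomials in the variables \<open>I\<close> with nonnegative
  integer coefficients, generated from monomials so that products and values can be treated by
  induction.\<close>

inductive_set positive_polys :: "'i set \<Rightarrow> (('i \<Rightarrow>\<^sub>0 nat) \<Rightarrow>\<^sub>0 int) set" for I where
  monomial: "Poly_Mapping.keys m \<subseteq> I \<Longrightarrow> Poly_Mapping.single m 1 \<in> positive_polys I"
| add: "p \<in> positive_polys I \<Longrightarrow> q \<in> positive_polys I \<Longrightarrow> p + q \<in> positive_polys I"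

lemma positive_polys_nonneg:
  "p \<in> positive_polys I \<Longrightarrow> 0 \<le> Poly_Mapping.lookup p m"
  by (induction rule: positive_polys.induct) (auto simp: lookup_single lookup_add when_def)

text \<open>Nonnegative coefficients cannot cancel, so a nonzero coefficient of \<open>p\<close>
  survives in \<open>p + q\<close>.\<close>

lemma positive_polys_nonzero:
  "p \<in> positive_polys I \<Longrightarrow> p \<noteq> 0"
proof (induction rule: positive_polys.induct)
  case (monomial m)
  then show ?case by (metis lookup_single_eq lookup_zero zero_neq_one)
next
  case (add p q)
  then obtain m where "Poly_Mapping.lookup p m \<noteq> 0" by (metis lookup_zero poly_mapping_eqI)
  then have "Poly_Mapping.lookup (p + q) m \<noteq> 0"
    using positive_polys_nonneg[OF add(1), of m] positive_polys_nonneg[OF add(2), of m]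
    by (simp add: lookup_add)
  then show ?case by auto
qed

lemma positive_polys_keys:
  "p \<in> positive_polys I \<Longrightarrow> m \<in> Poly_Mapping.keys p \<Longrightarrow> Poly_Mapping.keys m \<subseteq> I"
proof (induction rule: positive_polys.induct)
  case (add p q)
  then show ?case using Poly_Mapping.keys_add[of p q] by blast
qed auto

lemma positive_polys_mult:
  assumes "p \<in> positive_polys I" "q \<in> positive_polys I"
  shows "p * q \<in> positive_polys I"
  using assms(1)
proof (induction rule: positive_polys.induct)
  case m: (monomial m)
  show ?case
    using assms(2)
  proof (induction rule: positive_polys.induct)
    case (monomial m')
    have "Poly_Mapping.keys (m + m') \<subseteq> I"
      using m monomial Poly_Mapping.keys_add[of m m'] by blast
    then show ?case by (simp add: mult_single positive_polys.monomial)
  qed (simp add: distrib_left positive_polys.add)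
qed (simp add: distrib_right positive_polys.add)

lemma one_in_positive_polys: "1 \<in> positive_polys I"
  using positive_polys.monomial[of 0 I] by simp

section \<open>Evaluation of polynomials\<close>

lemma poly_at_superset:
  assumes "finite A" "Poly_Mapping.keys p \<subseteq> A"
  shows "poly_at g p = (\<Sum>m\<in>A. of_int (Poly_Mapping.lookup p m) *
    (\<Prod>v\<in>Poly_Mapping.keys m. g v ^ Poly_Mapping.lookup m v))"
  unfolding poly_at_def using assms by (intro sum.mono_neutral_left) (auto simp: in_keys_iff)

text \<open>The supports of \<open>p\<close>, \<open>q\<close> and \<open>p + q\<close> may differ;
  summing over a common finite superset allows a termwise comparison.\<close>

lemma poly_at_add: "poly_at g (p + q) = poly_at g p + poly_at g q"
proof -
  define A where "A = Poly_Mapping.keys p \<union> Poly_Mapping.keys q"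
  have "finite A" "Poly_Mapping.keys p \<subseteq> A" "Poly_Mapping.keys q \<subseteq> A" "Poly_Mapping.keys (p + q) \<subseteq> A"
    using Poly_Mapping.keys_add[of p q] by (auto simp: A_def)
  then show ?thesis
    by (simp add: poly_at_superset lookup_add distrib_right sum.distrib)
qed

lemma poly_at_diff: "poly_at g (p - q) = poly_at g p - poly_at g q"
  using poly_at_add[of g "p - q" q] by simp

lemma poly_at_monomial:
  "poly_at g (Poly_Mapping.single m 1) = (\<Prod>v\<in>Poly_Mapping.keys m. g v ^ Poly_Mapping.lookup m v)"
  by (simp add: poly_at_def)

lemma poly_at_monomial_mult:
  "poly_at g (Poly_Mapping.single (m + m') 1) =
     poly_at g (Poly_Mapping.single m 1) * poly_at g (Poly_Mapping.single m' 1)"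
proof -
  define A where "A = Poly_Mapping.keys m \<union> Poly_Mapping.keys m'"
  have *: "(\<Prod>v\<in>Poly_Mapping.keys n. g v ^ Poly_Mapping.lookup n v) = (\<Prod>v\<in>A. g v ^ Poly_Mapping.lookup n v)"
    if "Poly_Mapping.keys n \<subseteq> A" for n
    using that by (intro prod.mono_neutral_left) (auto simp: A_def in_keys_iff)
  have sub: "Poly_Mapping.keys (m + m') \<subseteq> A" "Poly_Mapping.keys m \<subseteq> A" "Poly_Mapping.keys m' \<subseteq> A"
    using Poly_Mapping.keys_add[of m m'] by (auto simp: A_def)
  show ?thesis
    unfolding poly_at_monomial sub[THEN *] by (simp add: lookup_add power_add prod.distrib)
qed

text \<open>Induction on both factors reduces the claim to two monomials, whose exponents
  add.\<close>

lemma poly_at_mult: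
  assumes "p \<in> positive_polys I" "q \<in> positive_polys J"
  shows "poly_at g (p * q) = poly_at g p * poly_at g q"
  using assms(1)
proof (induction rule: positive_polys.induct)
  case m: (monomial m)
  show ?case
    using assms(2)
    by (induction rule: positive_polys.induct)
      (simp_all add: mult_single poly_at_monomial_mult distrib_left poly_at_add)
qed (simp add: distrib_right poly_at_add)

lemma poly_at_one: "poly_at g 1 = 1"
  using poly_at_monomial[of g 0] by simp

lemma poly_at_positive_in:
  assumes "subsemifield F" "\<And>v. v \<in> I \<Longrightarrow> g v \<in> F" "p \<in> positive_polys I"
  shows "poly_at g p \<in> F"
  using assms(3)
proof (induction rule: positive_polys.induct)
  case (monomial m)
  then show ?case
    using assms(1,2) unfolding poly_at_monomial
    by (intro mult_subgroup_prod mult_subgroup_power) (auto simp: subsemifield_def)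
next
  case (add p q)
  then show ?case using assms(1) by (simp add: poly_at_add subsemifield_def)
qed

section \<open>Quotients of positive polynomials and substitution\<close>

definition positive_quotients :: "'i set \<Rightarrow> ('i \<Rightarrow> 'f::field) \<Rightarrow> 'f set" where
  "positive_quotients I g = {poly_at g p / poly_at g q | p q. p \<in> positive_polys I \<and> q \<in> positive_polys I}"

text \<open>A difference \<open>p - q\<close> of value 0 is an algebraic relation among the
  \<open>g v\<close>, so it vanishes. It need not be positive, hence the additivity of
  \<open>poly_at\<close> for arbitrary polynomials.\<close>

lemma alg_independent_positive_eq:
  assumes "alg_independent I g" "p \<in> positive_polys I" "q \<in> positive_polys I"
    "poly_at g p = poly_at g q"
  shows "p = q"
proof -
  have "\<forall>m\<in>Poly_Mapping.keys (p - q). Poly_Mapping.keys m \<subseteq> I"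
    using positive_polys_keys[OF assms(2)] positive_polys_keys[OF assms(3)] keys_diff[of p q] by blast
  moreover have "poly_at g (p - q) = 0" using assms(4) by (simp add: poly_at_diff)
  ultimately have "p - q = 0" using assms(1) unfolding alg_independent_def by blast
  then show ?thesis by simp
qed

lemma alg_independent_positive_nonzero:
  assumes "alg_independent I g" "p \<in> positive_polys I"
  shows "poly_at g p \<noteq> 0"
  using assms positive_polys_nonzero positive_polys_keys unfolding alg_independent_def by blast

text \<open>Common denominators keep sums in the set; independence ensures that no numerator and no
  denominator evaluates to 0.\<close>

lemma subsemifield_positive_quotients:
  assumes "alg_independent I g"
  shows "subsemifield (positive_quotients I g)"
proof -
  let ?Q = "positive_quotients I g"
  note nz = alg_independent_positive_nonzero[OF assms]
  have quot: "poly_at g p / poly_at g q \<in> ?Q" if "p \<in> positive_polys I" "q \<in> positive_polys I" for p q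
    using that by (auto simp: positive_quotients_def)
  have "a + b \<in> ?Q \<and> a * b \<in> ?Q \<and> a / b \<in> ?Q" if "a \<in> ?Q" "b \<in> ?Q" for a b
  proof -
    from that obtain p q p' q' where pq: "p \<in> positive_polys I" "q \<in> positive_polys I"
      "p' \<in> positive_polys I" "q' \<in> positive_polys I"
      and ab: "a = poly_at g p / poly_at g q" "b = poly_at g p' / poly_at g q'"
      by (auto simp: positive_quotients_def)
    have "a + b = poly_at g (p * q' + p' * q) / poly_at g (q * q')"
      using pq nz by (simp add: ab poly_at_add poly_at_mult field_simps)
    moreover have "a * b = poly_at g (p * p') / poly_at g (q * q')"
      using pq by (simp add: ab poly_at_mult)
    moreover have "a / b = poly_at g (p * q') / poly_at g (q * p')"
      using pq by (simp add: ab poly_at_mult)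
    ultimately show ?thesis
      using pq quot by (simp add: positive_polys_mult positive_polys.add)
  qed
  moreover have "0 \<notin> ?Q" using nz by (auto simp: positive_quotients_def)
  moreover have "1 \<in> ?Q" using quot[OF one_in_positive_polys one_in_positive_polys] by (simp add: poly_at_one)
  ultimately show ?thesis by (simp add: subsemifield_def mult_subgroup_def)
qed

lemma poly_at_variable: "poly_at g (Poly_Mapping.single (Poly_Mapping.single v 1) 1) = g v"
  by (simp add: poly_at_monomial)

lemma family_in_positive_quotients:
  assumes "v \<in> I"
  shows "g v \<in> positive_quotients I g"
proof -
  have "Poly_Mapping.single (Poly_Mapping.single v 1) 1 \<in> positive_polys I"
    using assms by (intro positive_polys.monomial) simp
  then show ?thesis
    unfolding positive_quotients_def using one_in_positive_polys
    by (intro CollectI exI[of _ "Poly_Mapping.single (Poly_Mapping.single v 1) 1"] exI[of _ 1])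
      (simp add: poly_at_variable[simplified] poly_at_one)
qed

text \<open>
  A quotient of positive polynomials in \<open>g\<close> determines the quotient of the same polynomials in
  \<open>h\<close>, because cross multiplication turns equality of quotients into a polynomial identity.
\<close>

lemma substitution_hom:
  assumes indep: "alg_independent I g" and F: "subsemifield F" and h: "\<And>v. v \<in> I \<Longrightarrow> h v \<in> F"
  obtains \<psi> where "semifield_hom (positive_quotients I g) F \<psi>" "\<And>v. v \<in> I \<Longrightarrow> \<psi> (g v) = h v"
proof -
  let ?Q = "positive_quotients I g"
  \<comment> \<open>\<open>rep f\<close> describes the ways to write \<open>f\<close> as a positive
    quotient in \<open>g\<close>; \<psi> evaluates an arbitrarily chosen one at
    \<open>h\<close>.\<close>
  define rep where "rep = (\<lambda>f (p, q). p \<in> positive_polys I \<and> q \<in> positive_polys I \<and>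
    f = poly_at g p / poly_at g q)"
  define \<psi> where "\<psi> f = (let (p, q) = (SOME pq. rep f pq) in poly_at h p / poly_at h q)" for f
  note nz = alg_independent_positive_nonzero[OF indep]
  note hF = poly_at_positive_in[OF F, of I h, OF h]
  have hnz: "poly_at h p \<noteq> 0" if "p \<in> positive_polys I" for p
    using hF[OF _ that] F by (auto simp: subsemifield_def mult_subgroup_def)
  have \<psi>: "\<psi> (poly_at g p / poly_at g q) = poly_at h p / poly_at h q"
    if pq: "p \<in> positive_polys I" "q \<in> positive_polys I" for p q
  proof -
    let ?f = "poly_at g p / poly_at g q"
    obtain p' q' where s: "(SOME pq. rep ?f pq) = (p', q')" by fastforce
    have "rep ?f (p, q)" using pq by (simp add: rep_def)
    then have r: "rep ?f (p', q')" unfolding s[symmetric] by (rule someI)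
    then have pos: "p' \<in> positive_polys I" "q' \<in> positive_polys I"
      and eq: "?f = poly_at g p' / poly_at g q'"
      by (auto simp: rep_def)
    have "poly_at g (p * q') = poly_at g (p' * q)"
      using eq pq pos nz by (simp add: poly_at_mult field_simps)
    then have "p * q' = p' * q"
      using alg_independent_positive_eq[OF indep] pq pos positive_polys_mult by blast
    then have "poly_at h p * poly_at h q' = poly_at h p' * poly_at h q"
      using pq pos by (metis poly_at_mult)
    then show ?thesis
      using pq pos hnz by (simp add: \<psi>_def s field_simps)
  qed
  have "semifield_hom ?Q F \<psi>"
    unfolding semifield_hom_def
  proof (intro conjI ballI)
    show "\<psi> ` ?Q \<subseteq> F"
      using hF F by (auto simp: positive_quotients_def \<psi> subsemifield_def mult_subgroup_def)
    fix a b assume "a \<in> ?Q" "b \<in> ?Q"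
    then obtain p q p' q' where pq: "p \<in> positive_polys I" "q \<in> positive_polys I"
      "p' \<in> positive_polys I" "q' \<in> positive_polys I"
      and ab: "a = poly_at g p / poly_at g q" "b = poly_at g p' / poly_at g q'"
      by (auto simp: positive_quotients_def)
    have s: "a + b = poly_at g (p * q' + p' * q) / poly_at g (q * q')"
      using pq nz by (simp add: ab poly_at_add poly_at_mult field_simps)
    have m: "a * b = poly_at g (p * p') / poly_at g (q * q')"
      using pq by (simp add: ab poly_at_mult)
    have "\<psi> (a + b) = poly_at h (p * q' + p' * q) / poly_at h (q * q')"
      unfolding s using pq by (intro \<psi> positive_polys_mult positive_polys.add)
    also have "\<dots> = \<psi> a + \<psi> b"
      using pq hnz by (simp add: ab \<psi> poly_at_add poly_at_mult field_simps)
    finally show "\<psi> (a + b) = \<psi> a + \<psi> b" .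
    have "\<psi> (a * b) = poly_at h (p * p') / poly_at h (q * q')"
      unfolding m using pq by (intro \<psi> positive_polys_mult)
    also have "\<dots> = \<psi> a * \<psi> b"
      using pq by (simp add: ab \<psi> poly_at_mult)
    finally show "\<psi> (a * b) = \<psi> a * \<psi> b" .
  qed
  moreover have "\<psi> (g v) = h v" if "v \<in> I" for v
  proof -
    have "Poly_Mapping.single (Poly_Mapping.single v 1) 1 \<in> positive_polys I"
      using that by (intro positive_polys.monomial) simp
    from \<psi>[OF this one_in_positive_polys] show ?thesis
      unfolding poly_at_variable poly_at_one by simp
  qed
  ultimately show thesis using that by blast
qed

section \<open>Monomials of the cyclic algebra\<close>

lemma residue_bounds: "0 < l \<Longrightarrow> residue l m \<in> {1..l}"
  using pos_mod_bound[of "int l" "m - 1"] pos_mod_sign[of "int l" "m - 1"]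
  by (simp add: residue_def nat_less_iff Suc_le_eq)

lemma residue_mod: "0 < l \<Longrightarrow> int (residue l m) mod int l = m mod int l"
  by (simp add: residue_def add.commute mod_add_right_eq)

lemma residue_cong: "m mod int l = n mod int l \<Longrightarrow> residue l m = residue l n"
  unfolding residue_def by (metis mod_diff_left_eq)

lemma residue_eqI: "n \<in> {1..l} \<Longrightarrow> m mod int l = int n mod int l \<Longrightarrow> residue l m = n"
  using residue_cong[of m l "int n"] by (auto simp: residue_def)

text \<open>The shift can be undone modulo \<open>l\<close>, so the map is injective, and an
  injective self-map of a finite set is bijective.\<close>

lemma bij_betw_residue_shift:
  assumes "0 < l"
  shows "bij_betw (\<lambda>i. residue l (int i + c)) {1..l} {1..l}"
proof -
  have "inj_on (\<lambda>i. residue l (int i + c)) {1..l}"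
  proof (rule inj_onI)
    fix i j assume ij: "i \<in> {1..l}" "j \<in> {1..l}" "residue l (int i + c) = residue l (int j + c)"
    then have "(int i + c) mod int l = (int j + c) mod int l"
      using residue_mod[OF assms] by metis
    then have "(int i + c - c) mod int l = (int j + c - c) mod int l"
      by (rule mod_diff_cong) simp
    then have "int i mod int l = int j mod int l" by simp
    then show "i = j" using ij(1,2) residue_cong residue_eqI by metis
  qed
  moreover have "(\<lambda>i. residue l (int i + c)) ` {1..l} \<subseteq> {1..l}"
    using residue_bounds[OF assms] by blast
  ultimately show ?thesis
    by (simp add: bij_betw_def endo_inj_surj)
qed

text \<open>This is f_m of the overview. The integer index admits negative shifts, as in
  \<psi>(M_{i,i}) = f_{i-1}.\<close>

definition cyc_frozen :: "nat \<Rightarrow> nat \<Rightarrow> int \<Rightarrow> ratfun" where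
  "cyc_frozen k l m = cyc_x (Nkl k l + residue l m)"

lemma cyc_frozen_cong: "m mod int l = n mod int l \<Longrightarrow> cyc_frozen k l m = cyc_frozen k l n"
  using residue_cong[of m l n] by (simp add: cyc_frozen_def)

lemma cyc_frozen_shift: "cyc_frozen k l (m + int l) = cyc_frozen k l m"
  by (rule cyc_frozen_cong) simp

lemma cyc_x_nonzero [simp]: "cyc_x i \<noteq> 0"
  by (simp add: cyc_x_def indet_nonzero)

lemma cyc_frozen_nonzero [simp]: "cyc_frozen k l m \<noteq> 0"
  by (simp add: cyc_frozen_def)

text \<open>Among \<open>l\<close> consecutive indices every residue occurs once. The shift
  \<open>c\<close> will be -1 for the entries M_{i,i} and k for the entries M_{i,i+k}.\<close>

lemma prod_cyc_frozen:
  assumes "0 < l"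
  shows "(\<Prod>i=1..l. cyc_frozen k l (int i + c)) = (\<Prod>i=1..l. cyc_x (Nkl k l + i))"
  unfolding cyc_frozen_def by (rule prod.reindex_bij_betw[OF bij_betw_residue_shift[OF assms]])

text \<open>The shift comes from \<open>Nkl k l + k - 1 = (k - 1) * l\<close>, a multiple of \<open>l\<close>.\<close>

lemma cyc_x_frozen:
  assumes "1 \<le> k" "0 < l" "Nkl k l < m" "m \<le> Nkl k l + l"
  shows "cyc_x m = cyc_frozen k l (int m + int k - 1)"
proof -
  have "int (Nkl k l) + int k - 1 = (int k - 1) * int l"
    using assms(1,2) by (cases k; cases l) (simp_all add: Nkl_def algebra_simps)
  then have "int m + int k - 1 = int (m - Nkl k l) + (int k - 1) * int l"
    using assms(3) by (simp add: of_nat_diff)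
  then have "(int m + int k - 1) mod int l = int (m - Nkl k l) mod int l"
    by simp
  then have "residue l (int m + int k - 1) = m - Nkl k l"
    using assms by (intro residue_eqI) auto
  then show ?thesis using assms by (simp add: cyc_frozen_def)
qed

text \<open>
  The value 1 beyond \<open>Nkl k l\<close> matches the omitted factors of \<open>gsv_yhat\<close>; it makes
  \<open>image_x_telescope\<close> hold up to \<open>n = Nkl k l + 1\<close>.
\<close>

definition image_x :: "nat \<Rightarrow> nat \<Rightarrow> nat \<Rightarrow> ratfun" where
  "image_x k l i = (if i > Nkl k l then 1
     else cyc_x i * (\<Prod>b=i..<Nkl k l. cyc_frozen k l (int (b + k))))"

lemma image_x_nonzero [simp]: "image_x k l i \<noteq> 0"
  by (simp add: image_x_def)

lemma image_x_telescope:
  assumes "1 \<le> k" "0 < l" "m \<le> n" "n \<le> Nkl k l + 1"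
  shows "image_x k l m / image_x k l n = cyc_x m / cyc_x n * (\<Prod>b=m..<n. cyc_frozen k l (int (b + k)))"
proof -
  let ?f = "\<lambda>b. cyc_frozen k l (int (b + k))"
  consider "n \<le> Nkl k l" | "n = Nkl k l + 1" "m = n" | "n = Nkl k l + 1" "m \<le> Nkl k l"
    using assms by linarith
  then show ?thesis
  proof cases
    case 1
    then have "(\<Prod>b=m..<Nkl k l. ?f b) = (\<Prod>b=m..<n. ?f b) * (\<Prod>b=n..<Nkl k l. ?f b)"
      using assms by (simp add: prod.atLeastLessThan_concat)
    then show ?thesis using 1 assms by (simp add: image_x_def)
  next
    case 2
    then show ?thesis by simp
  next
    case 3
    \<comment> \<open>At n = N + 1, with N = \<open>Nkl k l\<close>, the product on the right gains
      the factor b = N; division by the first frozen variable cancels it.\<close>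
    have "cyc_x n = ?f (Nkl k l)"
      using 3 assms by (subst cyc_x_frozen[of k l]) (auto simp: algebra_simps)
    then show ?thesis using 3 by (simp add: image_x_def)
  qed
qed

lemma image_x_step:
  assumes "1 \<le> k" "0 < l" "m \<le> Nkl k l"
  shows "image_x k l m / image_x k l (m + 1) = cyc_x m / cyc_x (m + 1) * cyc_frozen k l (int (m + k))"
  using image_x_telescope[of k l m "m + 1"] assms by simp

lemma image_yhat_mutable:
  assumes "2 \<le> k" "k < l" "2 \<le> i" "i \<le> Nkl k l"
  shows "(image_x k l (i + 1) * (if i \<le> l then 1 else image_x k l (i - l)) * image_x k l (i + l - 1)) /
      (image_x k l (i + l) * image_x k l (i - 1) * (if i \<le> l then 1 else image_x k l (i - l + 1))) *
      ((if i \<le> l then cyc_frozen k l (int (i + k)) else 1) *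
       (if Nkl k l + 2 \<le> i + l then cyc_frozen k l (int (i + k) - 2) else 1)) = cyc_yhat k l i s"
    (is "(?y1 * ?yb * ?yc) / (?yd * ?ye * ?yf) * (?B * ?C) = _")
proof -
  let ?f = "cyc_frozen k l" let ?x = cyc_x
  let ?u = "if i \<le> l then 1 else ?x (i - l)" and ?v = "if i \<le> l then 1 else ?x (i - l + 1)"
  have kl: "1 \<le> k" "0 < l" using assms by auto
  have "?ye / ?y1 = ?x (i - 1) / ?x (i + 1) * (\<Prod>b=i - 1..<i + 1. ?f (int (b + k)))"
    using assms by (intro image_x_telescope) auto
  also have "{i - 1..<i + 1} = {i - 1, i}" using assms by auto
  finally have "?ye / ?y1 = ?x (i - 1) / ?x (i + 1) * (?f (int (i + k) - 1) * ?f (int (i + k)))"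
    using assms by (simp add: of_nat_diff algebra_simps)
  then have a: "?y1 / ?ye = ?x (i + 1) / ?x (i - 1) / (?f (int (i + k) - 1) * ?f (int (i + k)))"
    by (simp add: field_simps)
  have b: "?yb / ?yf * ?B = ?u / ?v * ?f (int (i + k))"
  proof (cases "i \<le> l")
    case False
    then have "?f (int (i - l + k)) = ?f (int (i + k))"
      using cyc_frozen_shift[of k l "int (i - l + k)"] by (simp add: of_nat_diff algebra_simps)
    then show ?thesis using False image_x_step[OF kl, of "i - l"] assms by simp
  qed simp
  \<comment> \<open>If both indices exceed \<open>Nkl k l\<close>, both images are 1, while
    x_{i+l-1} = f_{i+k-2} and x_{i+l} = f_{i+k-1} are frozen; the right-hand side then reduces to
    f_{i+k-2}, the image of M_{i+k-1,i+k-1}.\<close>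
  have c: "?yc / ?yd * ?C = ?x (i + l - 1) / ?x (i + l) * ?f (int (i + k) - 1)"
  proof (cases "Nkl k l + 2 \<le> i + l")
    case True
    have "?x (i + l - 1) = ?f (int (i + l - 1) + int k - 1)" "?x (i + l) = ?f (int (i + l) + int k - 1)"
      using True assms by (intro cyc_x_frozen; simp)+
    moreover have "?f (int (i + l - 1) + int k - 1) = ?f (int (i + k) - 2)"
      "?f (int (i + l) + int k - 1) = ?f (int (i + k) - 1)"
      using cyc_frozen_shift[of k l "int (i + k) - 2"] cyc_frozen_shift[of k l "int (i + k) - 1"] assms
      by (simp_all add: of_nat_diff algebra_simps)
    ultimately show ?thesis using True by (simp add: image_x_def)
  next
    case False
    have "?f (int (i + l - 1 + k)) = ?f (int (i + k) - 1)"
      using cyc_frozen_shift[of k l "int (i + k) - 1"] assms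
      by (simp add: of_nat_diff algebra_simps)
    then show ?thesis using False image_x_step[OF kl, of "i + l - 1"] assms by simp
  qed
  have regroup: "a * b * c / (d * e * f) * (B * C) = (a / e) * (b / f * B) * (c / d * C)"
    for a b c d e f B C :: ratfun
    by (simp add: mult_ac)
  have "(?y1 * ?yb * ?yc) / (?yd * ?ye * ?yf) * (?B * ?C) = (?y1 / ?ye) * (?yb / ?yf * ?B) * (?yc / ?yd * ?C)"
    by (simp only: regroup)
  also have "\<dots> = (?x (i + 1) * ?u * ?x (i + l - 1)) / (?x (i + l) * ?x (i - 1) * ?v)"
    unfolding a b c by (simp add: mult_ac)
  also have "\<dots> = cyc_yhat k l i s"
    using assms by (simp add: cyc_yhat_def)
  finally show ?thesis .
qed

text \<open>For k > 2 this is the telescoping from 2 to l + 1. For k = 2 one has l = N + 1, so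
  telescoping stops at l; there x_l = f_1 cancels against the image of M_{2,2}, and x_{l+1} =
  f_{l+k} cancels the last factor of the product.\<close>

lemma image_yhat_first:
  assumes "2 \<le> k" "k < l"
  shows "image_x k l 2 / (if k = 2 then 1 / cyc_frozen k l 1 else image_x k l (l + 1)) =
    cyc_x 2 / cyc_x (l + 1) * (\<Prod>i=2..l. cyc_frozen k l (int (i + k)))"
proof (cases "k = 2")
  case True
  let ?f = "\<lambda>b. cyc_frozen k l (int (b + k))"
  have N: "Nkl k l + 1 = l" using Nkl_bounds(2)[OF assms True] assms by simp
  have "image_x k l 2 / image_x k l l = cyc_x 2 / cyc_x l * (\<Prod>b=2..<l. ?f b)"
    using assms N by (intro image_x_telescope) auto
  moreover have "image_x k l l = 1" using N by (simp add: image_x_def)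
  moreover have "cyc_x l = cyc_frozen k l 1" "cyc_x (l + 1) = ?f l"
    using assms N True cyc_x_frozen[of k l l] cyc_x_frozen[of k l "l + 1"]
      cyc_frozen_shift[of k l 1] by (auto simp: algebra_simps)
  moreover have "(\<Prod>i=2..l. ?f i) = (\<Prod>b=2..<l. ?f b) * ?f l"
    using assms by (simp add: prod.last_plus mult.commute flip: atLeastLessThanSuc_atLeastAtMost)
  ultimately show ?thesis using True by simp
next
  case False
  then have "l + 1 \<le> Nkl k l" using Nkl_bounds(3)[OF assms] assms by simp
  then show ?thesis
    using image_x_telescope[of k l 2 "l + 1"] assms False
    by (simp add: atLeastLessThanSuc_atLeastAtMost)
qed

section \<open>No zero in the cyclic semifield\<close>

definition fract_positive_quotients :: "ratfun set" where
  "fract_positive_quotients = {Fract p q | p q. p \<in> positive_polys UNIV \<and> q \<in> positive_polys UNIV}"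

lemma subsemifield_fract_positive_quotients: "subsemifield fract_positive_quotients"
proof -
  note nz = positive_polys_nonzero[where I = UNIV]
  have quot: "Fract p q \<in> fract_positive_quotients" if "p \<in> positive_polys UNIV" "q \<in> positive_polys UNIV"
    for p q
    using that unfolding fract_positive_quotients_def by blast
  have "a + b \<in> fract_positive_quotients \<and> a * b \<in> fract_positive_quotients \<and> a / b \<in> fract_positive_quotients"
    if "a \<in> fract_positive_quotients" "b \<in> fract_positive_quotients" for a b
  proof -
    from that obtain p q p' q' where pq: "p \<in> positive_polys UNIV" "q \<in> positive_polys UNIV"
      "p' \<in> positive_polys UNIV" "q' \<in> positive_polys UNIV" and ab: "a = Fract p q" "b = Fract p' q'"
      unfolding fract_positive_quotients_def by blast
    have "a + b = Fract (p * q' + p' * q) (q * q')" "a * b = Fract (p * p') (q * q')"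
      "a / b = Fract (p * q') (q * p')"
      unfolding ab using nz[OF pq(2)] nz[OF pq(4)] by simp_all
    then show ?thesis
      using pq by (simp only: quot positive_polys_mult positive_polys.add simp_thms)
  qed
  moreover have "0 \<notin> fract_positive_quotients"
  proof
    assume "0 \<in> fract_positive_quotients"
    then obtain p q where "p \<in> positive_polys UNIV" "q \<in> positive_polys UNIV" "0 = (Fract p q :: ratfun)"
      unfolding fract_positive_quotients_def by blast
    then show False using nz[of p] nz[of q] by (simp add: Zero_fract_def eq_fract)
  qed
  moreover have "1 \<in> fract_positive_quotients"
    unfolding One_fract_def by (intro quot one_in_positive_polys)
  ultimately show ?thesis by (simp add: subsemifield_def mult_subgroup_def)
qed

lemma indet_in_fract_positive_quotients: "indet v \<in> fract_positive_quotients"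
proof -
  have "Poly_Mapping.single (Poly_Mapping.single v 1) 1 \<in> positive_polys UNIV"
    by (intro positive_polys.monomial) simp
  then show ?thesis
    using one_in_positive_polys[of UNIV] unfolding fract_positive_quotients_def indet_def by blast
qed

lemma cyc_z_nonzero [simp]: "cyc_z k s \<noteq> 0"
  by (simp add: cyc_z_def indet_nonzero)

lemma mult_subgroup_cyc_P: "mult_subgroup (cyc_P k l)"
  unfolding cyc_P_def using cyc_x_nonzero cyc_z_nonzero
  by (intro mult_subgroup_laurent_monomials) (metis UnE imageE)

lemma cyc_P_gen:
  "i \<in> {Nkl k l + 1..Nkl k l + l} \<Longrightarrow> cyc_x i \<in> cyc_P k l"
  "s \<le> k \<Longrightarrow> cyc_z k s \<in> cyc_P k l"
proof -
  have sub: "cyc_x ` {Nkl k l + 1..Nkl k l + l} \<union> cyc_z k ` {1..k - 1} \<subseteq> cyc_P k l"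
    unfolding cyc_P_def by (intro subset_laurent_monomials) simp
  show "i \<in> {Nkl k l + 1..Nkl k l + l} \<Longrightarrow> cyc_x i \<in> cyc_P k l"
    using sub by blast
  show "cyc_z k s \<in> cyc_P k l" if s: "s \<le> k"
  proof (cases "s = 0 \<or> s = k")
    case True
    then show ?thesis using mult_subgroup_cyc_P by (auto simp: cyc_z_def mult_subgroup_def)
  next
    case False
    then have "s \<in> {1..k - 1}" using s by auto
    then show ?thesis using sub by blast
  qed
qed

lemma cyc_frozen_in_cyc_P: "0 < l \<Longrightarrow> cyc_frozen k l m \<in> cyc_P k l"
  unfolding cyc_frozen_def using residue_bounds[of l m] by (intro cyc_P_gen) auto

text \<open>All generators lie in \<open>fract_positive_quotients\<close>, a subsemifield of the
  rational functions that excludes 0; hence no subtraction-free expression in them vanishes.\<close>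

lemma subsemifield_cyc:
  assumes "0 < l"
  shows "subsemifield (seed_semifield (cyc_P k l) (cyc_seed k l))"
proof -
  let ?G = "clv (cyc_seed k l) ` {1..num (cyc_seed k l)} \<union> cyc_P k l"
  have "mult_subgroup fract_positive_quotients"
    using subsemifield_fract_positive_quotients by (simp add: subsemifield_def)
  then have "1 \<in> fract_positive_quotients" by (simp add: mult_subgroup_def)
  then have "cyc_x i \<in> fract_positive_quotients" "cyc_z k s \<in> fract_positive_quotients" for i s
    by (auto simp: cyc_x_def cyc_z_def indet_in_fract_positive_quotients)
  moreover from this have "cyc_P k l \<subseteq> fract_positive_quotients"
    unfolding cyc_P_def by (intro laurent_monomials_subset[OF \<open>mult_subgroup fract_positive_quotients\<close>]) auto
  ultimately have "?G \<subseteq> fract_positive_quotients"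
    by (auto simp: cyc_seed_def)
  then have "subtraction_free ?G \<subseteq> fract_positive_quotients"
    by (rule subtraction_free_subset[OF subsemifield_fract_positive_quotients])
  moreover have "0 \<notin> fract_positive_quotients"
    using \<open>mult_subgroup fract_positive_quotients\<close> by (simp add: mult_subgroup_def)
  moreover have "?G \<noteq> {}"
    using cyc_frozen_in_cyc_P[OF assms, of k 0] by auto
  ultimately show ?thesis
    unfolding seed_semifield_def by (intro subsemifield_subtraction_free) auto
qed

section \<open>The quasi-homomorphism\<close>

definition gsv_coeffs :: "nat \<Rightarrow> nat \<Rightarrow> ratfun set" where
  "gsv_coeffs k l = (\<lambda>i. band k l (int i) (int i)) ` {1..l} \<union>
     (\<lambda>i. band k l (int i) (int (i + k))) ` {1..l} \<union> gsv_c k l ` {1..k - 1}"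

lemma gsv_P_eq: "gsv_P k l = laurent_monomials (gsv_coeffs k l)"
  by (simp add: gsv_P_def gsv_coeffs_def)

lemma gsv_coeffs_subset: "gsv_coeffs k l \<subseteq> gsv_P k l"
  unfolding gsv_P_eq by (rule subset_laurent_monomials) (simp add: gsv_coeffs_def)

text \<open>Periodicity under the simultaneous shift by \<open>l\<close> moves every entry to a row
  in \<open>{1..l}\<close>, where the generators of \<open>gsv_P\<close> are indexed.\<close>

lemma band_residue:
  assumes "0 < l"
  shows "band k l i (i + d) = band k l (int (residue l i)) (int (residue l i) + d)"
proof -
  have "residue l (int (residue l i)) = residue l i"
    by (rule residue_cong) (rule residue_mod[OF assms])
  then show ?thesis by (simp add: band_def)
qed

lemma gsv_coeffs_mem:
  assumes "0 < l"
  shows "band k l i i \<in> gsv_coeffs k l" "band k l i (i + int k) \<in> gsv_coeffs k l"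
    "s \<in> {1..k - 1} \<Longrightarrow> gsv_c k l s \<in> gsv_coeffs k l"
proof -
  show "band k l i i \<in> gsv_coeffs k l"
    using band_residue[OF assms, of k i 0] residue_bounds[OF assms, of i]
    unfolding gsv_coeffs_def by auto
  show "band k l i (i + int k) \<in> gsv_coeffs k l"
    using band_residue[OF assms, of k i "int k"] residue_bounds[OF assms, of i]
    unfolding gsv_coeffs_def by auto
qed (simp add: gsv_coeffs_def)

text \<open>\<open>yhat\<close> is built from cluster variables and coefficients by products,
  quotients and powers alone, all of which \<psi> respects on \<open>F\<close>.\<close>

lemma (in subsemifield_hom) yhat_map_seed:
  assumes "\<And>j. j \<in> {1..num S} \<Longrightarrow> clv S j \<in> F" "cof S i s \<in> F" "cof S i 0 \<in> F"
  shows "\<psi> (yhat S i s) = yhat (map_seed \<psi> S) i s"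
proof -
  have pow: "clv S j ^ n \<in> F" if "j \<in> {1..num S}" for j n
    using assms(1)[OF that] by (rule mult_subgroup_power[OF group])
  have M: "seed_Mplus S i \<in> F" "seed_Mminus S i \<in> F"
    unfolding seed_Mplus_def seed_Mminus_def by (intro mult_subgroup_prod[OF group] pow; simp)+
  have "\<psi> (seed_Mplus S i) = seed_Mplus (map_seed \<psi> S) i"
    unfolding seed_Mplus_def by (subst prod) (auto simp: pow power assms map_seed_def)
  moreover have "\<psi> (seed_Mminus S i) = seed_Mminus (map_seed \<psi> S) i"
    unfolding seed_Mminus_def by (subst prod) (auto simp: pow power assms map_seed_def)
  moreover have "seed_Mplus S i / seed_Mminus S i \<in> F" "cof S i s / cof S i 0 \<in> F"
    using M assms(2,3) group by (auto simp: mult_subgroup_def)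
  ultimately show ?thesis
    using M assms(2,3) mult_subgroup_power[OF group, of "seed_Mplus S i / seed_Mminus S i" s]
    by (simp only: yhat_def mult divide power) (simp add: map_seed_def)
qed

section \<open>The homomorphism and its values on generators\<close>

locale psi_star =
  fixes k l :: nat and \<psi> :: "ratfun \<Rightarrow> ratfun"
  assumes kl: "2 \<le> k" "k < l" and psi: "is_psi_star k l \<psi>"
begin

abbreviation "F \<equiv> seed_semifield (gsv_P k l) (gsv_seed k l)"
abbreviation "F' \<equiv> seed_semifield (cyc_P k l) (cyc_seed k l)"
abbreviation "fr \<equiv> cyc_frozen k l"

lemma l_pos: "0 < l" using kl by simp

sublocale subsemifield_hom F F' \<psi>
proof
  show "semifield_hom F F' \<psi>" using psi by (simp add: is_psi_star_def)
  show "subsemifield F'" by (rule subsemifield_cyc[OF l_pos])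
  moreover have "clv (gsv_seed k l) ` {1..num (gsv_seed k l)} \<union> gsv_P k l \<noteq> {}"
    using gsv_coeffs_mem(1)[OF l_pos] gsv_coeffs_subset by blast
  ultimately show "subsemifield F"
    \<comment> \<open>That \<open>F\<close> omits 0 is read off from \<psi>, whose target contains
      no 0.\<close>
    using subtraction_free_hom_dom \<open>semifield_hom F F' \<psi>\<close> unfolding seed_semifield_def by blast
qed

lemma gsv_P_F: "gsv_P k l \<subseteq> F"
  by (auto simp: seed_semifield_def intro: subtraction_free.gen)

lemma gsv_coeffs_F: "gsv_coeffs k l \<subseteq> F"
  using gsv_coeffs_subset gsv_P_F by blast

lemma gsv_x_F: "i \<in> {1..Nkl k l} \<Longrightarrow> gsv_x k l i \<in> F"
  by (auto simp: seed_semifield_def gsv_seed_def intro!: subtraction_free.gen)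

text \<open>The generators are nonzero because they lie in \<open>F\<close>, which excludes 0; no
  determinant has to be evaluated.\<close>

lemma mult_subgroup_gsv_P: "mult_subgroup (gsv_P k l)"
proof -
  have "0 \<notin> F" using group by (simp add: mult_subgroup_def)
  then have "0 \<notin> gsv_coeffs k l" by (rule contra_subsetD[OF gsv_coeffs_F])
  then show ?thesis unfolding gsv_P_eq by (rule mult_subgroup_laurent_monomials)
qed

lemma coeffs_P: "band k l i i \<in> gsv_P k l" "band k l i (i + int k) \<in> gsv_P k l"
    "s \<in> {1..k - 1} \<Longrightarrow> gsv_c k l s \<in> gsv_P k l"
  using gsv_coeffs_mem[OF l_pos] gsv_coeffs_subset by blast+

lemmas coeffs_F = coeffs_P[THEN subsetD[OF gsv_P_F]]

lemma psi_band: "\<psi> (band k l i i) = fr (i - 1)" "\<psi> (band k l i (i + int k)) = fr (i + int k)"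
proof -
  have "\<forall>i. \<psi> (band k l i i) = fr (i - 1) \<and> \<psi> (band k l (i - int k - 1) (i - 1)) = fr (i - 1)"
    using psi by (simp add: is_psi_star_def cyc_frozen_def)
  \<comment> \<open>Replacing \<open>i\<close> by \<open>i + int k + 1\<close> turns the entry (i -
    k - 1, i - 1) into (i, i + k).\<close>
  from this[rule_format, of i] this[rule_format, of "i + int k + 1"]
  show "\<psi> (band k l i i) = fr (i - 1)" "\<psi> (band k l i (i + int k)) = fr (i + int k)"
    by simp_all
qed

lemma psi_c: "s \<in> {1..k - 1} \<Longrightarrow> \<psi> (gsv_c k l s) = cyc_z k s * (\<Prod>i=1..l. cyc_x (Nkl k l + i))"
  using psi by (simp add: is_psi_star_def)

lemma psi_x: "i \<in> {1..Nkl k l} \<Longrightarrow> \<psi> (gsv_x k l i) = image_x k l i"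
  using psi by (simp add: is_psi_star_def image_x_def cyc_frozen_def)

section \<open>Images of the exchange coefficients and of the y-hats\<close>

lemma gsv_p1_in_P: "gsv_p1 k l s \<in> gsv_P k l"
proof -
  have "(\<Prod>i=1..l. band k l (int i) (int i)) \<in> gsv_P k l"
    by (intro mult_subgroup_prod[OF mult_subgroup_gsv_P] coeffs_P)
  moreover have "(\<Prod>i=2..l. band k l (int i) (int (i + k)) ^ n) \<in> gsv_P k l" for n
    using coeffs_P(2) by (intro mult_subgroup_prod[OF mult_subgroup_gsv_P] mult_subgroup_power[OF mult_subgroup_gsv_P]) simp
  moreover have "band k l 1 (int (1 + k)) \<in> gsv_P k l"
    using coeffs_P(2)[of 1] by simp
  ultimately show ?thesis
    using mult_subgroup_gsv_P coeffs_P(3)[of s] by (auto simp: gsv_p1_def mult_subgroup_def)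
qed

text \<open>Let R be the product of all frozen variables and Q the product of f_{i+k} over i = 2..l,
  so that R = f_{k+1} Q. The images of p_{1;0}, p_{1;s} and p_{1;k} are R Q^{k-1}, z_s R Q^{k-1-s}
  for 0 < s < k, and f_{k+1} = R/Q. Each is z_s Q^{-s} times the first; the identity is stated
  without division.\<close>

lemma psi_p1:
  assumes "s \<le> k"
  shows "\<psi> (gsv_p1 k l s) * (\<Prod>i=2..l. fr (int (i + k))) ^ s = cyc_z k s * \<psi> (gsv_p1 k l 0)"
proof -
  define Q where "Q = (\<Prod>i=2..l. fr (int (i + k)))"
  define R where "R = (\<Prod>i=1..l. cyc_x (Nkl k l + i))"
  have pow: "band k l (int i) (int (i + k)) ^ n \<in> F" for i n
    using mult_subgroup_power[OF group coeffs_F(2)] by simp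
  have band: "\<psi> (band k l (int i) (int (i + k))) = fr (int (i + k))" for i
    using psi_band(2)[of "int i"] by simp
  have Q: "\<psi> (\<Prod>i=2..l. band k l (int i) (int (i + k)) ^ n) = Q ^ n" for n
    using coeffs_F(2) by (subst prod) (simp_all only: pow, simp add: power band[simplified] Q_def prod_power_distrib)
  have R: "\<psi> (\<Prod>i=1..l. band k l (int i) (int i)) = R"
    using prod_cyc_frozen[OF l_pos, of k "- 1"]
    by (subst prod) (simp_all add: coeffs_F psi_band R_def)
  have "{1..l} = insert 1 {2..l}" using kl by auto
  then have RQ: "R = fr (int (1 + k)) * Q"
    using prod_cyc_frozen[OF l_pos, of k "int k"] by (simp add: R_def Q_def)
  have F: "(\<Prod>i=1..l. band k l (int i) (int i)) \<in> F" "(\<Prod>i=2..l. band k l (int i) (int (i + k)) ^ n) \<in> F" for n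
    by (intro mult_subgroup_prod[OF group] coeffs_F pow)+
  have 0: "\<psi> (gsv_p1 k l 0) = R * Q ^ (k - 1)"
    using F Q R by (simp add: gsv_p1_def mult)
  consider "s = 0" | "s \<in> {1..k - 1}" | "s = k" "k \<noteq> 0" using assms by fastforce
  then have "\<psi> (gsv_p1 k l s) * Q ^ s = cyc_z k s * (R * Q ^ (k - 1))"
  proof cases
    case 1
    then show ?thesis by (simp add: 0 cyc_z_def)
  next
    case 2
    then have "s < k" by auto
    with 2 have "\<psi> (gsv_p1 k l s) = cyc_z k s * R * Q ^ (k - 1 - s)"
      using F Q psi_c[OF 2] coeffs_F(3)[OF 2] by (simp add: gsv_p1_def mult R_def)
    moreover have "k - 1 = (k - 1 - s) + s" using 2 by auto
    then have "Q ^ (k - 1) = Q ^ (k - 1 - s) * Q ^ s" by (metis power_add)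
    ultimately show ?thesis by simp
  next
    case 3
    then have "\<psi> (gsv_p1 k l s) = fr (int (1 + k))"
      using psi_band(2)[of 1] by (simp add: gsv_p1_def)
    moreover have "Q ^ k = Q * Q ^ (k - 1)" using 3 by (simp flip: power_Suc)
    ultimately show ?thesis using 3 by (simp add: RQ cyc_z_def)
  qed
  then show ?thesis by (simp add: 0 Q_def)
qed

text \<open>The factor Q^s from the image of (x_2/x_{l+1})^s cancels the Q^{-s} from the
  coefficients.\<close>

lemma psi_yhat_first:
  assumes "s \<le> k"
  shows "\<psi> (gsv_yhat k l 1 s) = cyc_yhat k l 1 s"
proof -
  define Q where "Q = (\<Prod>i=2..l. fr (int (i + k)))"
  have Q0: "Q \<noteq> 0" by (simp add: Q_def)
  define d where "d = (if k = 2 then 1 / band k l 2 2 else gsv_x k l (l + 1))"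
  have p: "gsv_p1 k l s \<in> F" for s using gsv_p1_in_P gsv_P_F by blast
  have N: "2 \<in> {1..Nkl k l}" using Nkl_bounds(1)[OF kl] by simp
  have "d \<in> F \<and> \<psi> d = (if k = 2 then 1 / fr 1 else image_x k l (l + 1))"
  proof (cases "k = 2")
    case True
    then show ?thesis
      using group one_F coeffs_F(1)[of 2] divide[OF one_F coeffs_F(1)[of 2]] psi_band(1)[of 2]
      by (simp add: d_def one mult_subgroup_def)
  next
    case False
    then have "l + 1 \<in> {1..Nkl k l}" using Nkl_bounds(3)[OF kl] kl by simp
    from gsv_x_F[OF this] psi_x[OF this] False show ?thesis by (simp add: d_def)
  qed
  then have "\<psi> (gsv_x k l 2 / d) = cyc_x 2 / cyc_x (l + 1) * Q" and "gsv_x k l 2 / d \<in> F"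
    using divide gsv_x_F[OF N] psi_x[OF N] image_yhat_first[OF kl] group
    by (simp_all add: Q_def mult_subgroup_def)
  moreover from this have "(gsv_x k l 2 / d) ^ s \<in> F" "gsv_p1 k l s / gsv_p1 k l 0 \<in> F"
    using p group by (auto simp: mult_subgroup_def intro!: mult_subgroup_power)
  ultimately have "\<psi> (gsv_p1 k l s / gsv_p1 k l 0 * (gsv_x k l 2 / d) ^ s) =
      \<psi> (gsv_p1 k l s) / \<psi> (gsv_p1 k l 0) * (cyc_x 2 / cyc_x (l + 1) * Q) ^ s"
    using p \<open>gsv_x k l 2 / d \<in> F\<close> by (simp only: mult divide power)
  also have "\<dots> = (\<psi> (gsv_p1 k l s) * Q ^ s) / \<psi> (gsv_p1 k l 0) * (cyc_x 2 / cyc_x (l + 1)) ^ s"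
    by (simp add: power_mult_distrib power_divide)
  also have "\<dots> = cyc_z k s * (cyc_x 2 / cyc_x (l + 1)) ^ s"
    using psi_p1[OF assms] nonzero[OF p] by (simp add: Q_def)
  finally show ?thesis by (simp add: gsv_yhat_def cyc_yhat_def d_def Let_def)
qed

lemma gsv_frozen_in_P: "gsv_frozen k l i \<in> gsv_P k l"
  using mult_subgroup_gsv_P coeffs_P(1) coeffs_P(2)[of "int i"]
  by (auto simp: gsv_frozen_def mult_subgroup_def)

lemma psi_yhat_mutable:
  assumes "2 \<le> i" "i \<le> Nkl k l"
  shows "\<psi> (gsv_yhat k l i s) = cyc_yhat k l i s"
proof -
  define X where "X m = (if m > Nkl k l then 1 else gsv_x k l m)" for m
  \<comment> \<open>For \<open>i \<le> l\<close> the truncated difference \<open>i - l\<close> is 0,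
    an index at which \<open>X\<close> is not known to lie in \<open>F\<close>; \<open>L\<close>
    replaces these factors by 1.\<close>
  define L where "L j = (if i \<le> l then 1 else X j)" for j
  have X: "X m \<in> F" "\<psi> (X m) = image_x k l m" if "1 \<le> m" for m
    using that gsv_x_F[of m] psi_x[of m] one_F one by (auto simp: X_def image_x_def)
  have L: "L (i - l) \<in> F" "\<psi> (L (i - l)) = (if i \<le> l then 1 else image_x k l (i - l))"
    "L (i - l + 1) \<in> F" "\<psi> (L (i - l + 1)) = (if i \<le> l then 1 else image_x k l (i - l + 1))"
    using X[of "i - l"] X[of "i - l + 1"] one_F one by (auto simp: L_def)
  have fF: "gsv_frozen k l i \<in> F" using gsv_frozen_in_P gsv_P_F by blast
  have f: "\<psi> (gsv_frozen k l i) = (if i \<le> l then fr (int (i + k)) else 1) *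
      (if Nkl k l + 2 \<le> i + l then fr (int (i + k) - 2) else 1)"
  proof -
    have "\<psi> (band k l (int (i + k - 1)) (int (i + k - 1))) = fr (int (i + k) - 2)"
      using assms by (simp add: psi_band of_nat_diff)
    moreover have "\<psi> (band k l (int i) (int (i + k))) = fr (int (i + k))"
      using psi_band(2)[of "int i"] by simp
    moreover have "band k l (int i) (int (i + k)) \<in> F"
      using coeffs_F(2)[of "int i"] by simp
    ultimately show ?thesis
      using assms one_F one mult coeffs_F(1) by (simp add: gsv_frozen_def)
  qed
  have cl: "a * b \<in> F" "a / b \<in> F" if "a \<in> F" "b \<in> F" for a b
    using group that by (auto simp: mult_subgroup_def)
  have y: "gsv_yhat k l i s = (X (i + 1) * L (i - l) * X (i + l - 1)) / (X (i + l) * X (i - 1) * L (i - l + 1)) *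
      gsv_frozen k l i"
  proof (cases "i \<le> l")
    case False
    then have "i - l + 1 \<le> Nkl k l" using assms l_pos by linarith
    then show ?thesis using assms False by (simp add: gsv_yhat_def X_def L_def Let_def)
  qed (use assms in \<open>simp add: gsv_yhat_def X_def L_def Let_def\<close>)
  have "\<psi> (gsv_yhat k l i s) = (image_x k l (i + 1) * (if i \<le> l then 1 else image_x k l (i - l)) * image_x k l (i + l - 1)) /
      (image_x k l (i + l) * image_x k l (i - 1) * (if i \<le> l then 1 else image_x k l (i - l + 1))) *
      ((if i \<le> l then fr (int (i + k)) else 1) *
       (if Nkl k l + 2 \<le> i + l then fr (int (i + k) - 2) else 1))"
    unfolding y using assms X L f fF by (simp only: mult divide cl X L f)
  also have "\<dots> = cyc_yhat k l i s"
    by (rule image_yhat_mutable[OF kl assms])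
  finally show ?thesis .
qed

lemma psi_yhat:
  assumes "i \<in> {1..Nkl k l}" "s \<le> seed_degree k i"
  shows "\<psi> (gsv_yhat k l i s) = cyc_yhat k l i s"
  using assms psi_yhat_first[of s] psi_yhat_mutable[of i s] by (cases "i = 1") (auto simp: seed_degree_def)

section \<open>Quasi-homomorphism property and uniqueness\<close>

lemma psi_P: "\<psi> ` gsv_P k l \<subseteq> cyc_P k l"
  unfolding gsv_P_eq
proof (rule laurent_monomials_image[OF gsv_coeffs_F mult_subgroup_cyc_P])
  have "(\<Prod>i=1..l. cyc_x (Nkl k l + i)) \<in> cyc_P k l"
    by (intro mult_subgroup_prod[OF mult_subgroup_cyc_P] cyc_P_gen) auto
  moreover have "cyc_z k s \<in> cyc_P k l" if "s \<in> {1..k - 1}" for s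
    using that by (intro cyc_P_gen) auto
  ultimately have "\<psi> (gsv_c k l s) \<in> cyc_P k l" if "s \<in> {1..k - 1}" for s
    using that mult_subgroup_cyc_P by (simp add: psi_c mult_subgroup_def)
  then show "\<psi> ` gsv_coeffs k l \<subseteq> cyc_P k l"
    using psi_band cyc_frozen_in_cyc_P[OF l_pos] by (auto simp: gsv_coeffs_def)
qed

lemma psi_x_ratio:
  assumes "i \<in> {1..Nkl k l}"
  shows "\<psi> (gsv_x k l i) / cyc_x i \<in> cyc_P k l"
  using assms cyc_frozen_in_cyc_P[OF l_pos]
  by (simp add: psi_x image_x_def) (intro mult_subgroup_prod[OF mult_subgroup_cyc_P])

lemma gsv_cof_in_P: "cof (gsv_seed k l) i s \<in> gsv_P k l"
proof -
  have "1 \<in> gsv_P k l" using mult_subgroup_gsv_P by (simp add: mult_subgroup_def)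
  then have "gsv_p1 k l s * (if k = 2 then band k l 2 2 ^ s else 1) \<in> gsv_P k l"
    using mult_subgroup_gsv_P gsv_p1_in_P mult_subgroup_power[OF mult_subgroup_gsv_P coeffs_P(1), of 2 s]
    by (auto simp: mult_subgroup_def)
  then show ?thesis
    using mult_subgroup_power[OF mult_subgroup_gsv_P gsv_frozen_in_P] by (simp add: gsv_seed_def)
qed

lemma cyc_cof_in_P:
  assumes "s \<le> seed_degree k i"
  shows "cof (cyc_seed k l) i s \<in> cyc_P k l"
proof -
  note pow = mult_subgroup_power[OF mult_subgroup_cyc_P]
  have "(\<Prod>j=Nkl k l + 1..Nkl k l + l. cyc_x j ^ e j) ^ n \<in> cyc_P k l" for e n
    by (intro pow mult_subgroup_prod[OF mult_subgroup_cyc_P] cyc_P_gen)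
  moreover have "(if i = 1 then cyc_z k s else 1) \<in> cyc_P k l"
    using assms cyc_P_gen(2)[of s k l] mult_subgroup_cyc_P by (auto simp: seed_degree_def mult_subgroup_def)
  moreover have "a * b \<in> cyc_P k l" if "a \<in> cyc_P k l" "b \<in> cyc_P k l" for a b
    using mult_subgroup_cyc_P that by (simp add: mult_subgroup_def)
  ultimately show ?thesis by (simp add: cyc_seed_def)
qed

lemma psi_seed_equiv: "seed_equiv (cyc_P k l) (map_seed \<psi> (gsv_seed k l)) (cyc_seed k l)"
proof -
  have clv: "num (gsv_seed k l) = Nkl k l" "clv (gsv_seed k l) = gsv_x k l"
    by (simp_all add: gsv_seed_def)
  have yhat0: "yhat S i 0 = 1" if "cof S i 0 \<noteq> 0" for S :: "ratfun gseed" and i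
    using that by (simp add: yhat_def)
  have "yhat (map_seed \<psi> (gsv_seed k l)) i s = yhat (cyc_seed k l) i s"
    if i: "i \<in> {1..Nkl k l}" and s: "s \<le> seed_degree k i" for i s
  \<comment> \<open>The explicit formulas for \<open>yhat\<close> of the two seeds start at s = 1;
    at s = 0 both sides are 1 once the coefficients of index 0 are nonzero.\<close>
  proof (cases "s = 0")
    case True
    have "cof (map_seed \<psi> (gsv_seed k l)) i 0 \<noteq> 0"
      using nonzero gsv_cof_in_P[of i 0] gsv_P_F by (auto simp: map_seed_def)
    moreover have "cof (cyc_seed k l) i 0 \<noteq> 0"
      using cyc_cof_in_P[of 0 i] mult_subgroup_cyc_P by (auto simp: mult_subgroup_def)
    ultimately show ?thesis using True yhat0 by simp
  next
    case False
    have "yhat (map_seed \<psi> (gsv_seed k l)) i s = \<psi> (yhat (gsv_seed k l) i s)"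
      using gsv_x_F gsv_cof_in_P[THEN subsetD[OF gsv_P_F]] clv by (intro yhat_map_seed[symmetric]) simp_all
    also have "\<dots> = \<psi> (gsv_yhat k l i s)"
      using yhat_gsv_seed[OF kl] i s False by simp
    also have "\<dots> = yhat (cyc_seed k l) i s"
      using psi_yhat[OF i s] yhat_cyc_seed[OF kl] i s False by simp
    finally show ?thesis .
  qed
  moreover have "\<psi> (cof (gsv_seed k l) i s) \<in> cyc_P k l" for i s
    using gsv_cof_in_P psi_P by blast
  ultimately show ?thesis
    using psi_x_ratio cyc_cof_in_P
    by (simp add: seed_equiv_def seed_over_def map_seed_def[of _ "gsv_seed k l"])
      (simp add: gsv_seed_def cyc_seed_def)
qed

lemma psi_quasi_homomorphism:
  "quasi_homomorphism (gsv_P k l) (gsv_seed k l) (cyc_P k l) (cyc_seed k l) \<psi>"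
  using gsv_cof_in_P hom psi_P psi_seed_equiv by (simp add: quasi_homomorphism_def seed_over_def)

text \<open>Agreement passes from the matrix entries and \<open>gsv_c\<close> to Laurent monomials
  in them, and with the cluster variables from there to all subtraction-free expressions.\<close>

lemma psi_unique:
  assumes "is_psi_star k l \<psi>'" "f \<in> F"
  shows "\<psi> f = \<psi>' f"
proof -
  interpret other: psi_star k l \<psi>' by unfold_locales (use kl assms in auto)
  let ?c = "gsv_coeffs k l"
  have c: "\<psi> g = \<psi>' g" if "g \<in> ?c" for g
    using that psi_band other.psi_band psi_c other.psi_c by (auto simp: gsv_coeffs_def)
  have P: "\<psi> g = \<psi>' g" if "g \<in> gsv_P k l" for g
  proof -
    obtain e where g: "g = (\<Prod>x\<in>?c. x powi e x)"
      using \<open>g \<in> gsv_P k l\<close> unfolding gsv_P_eq laurent_monomials_def by blast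
    have "x powi e x \<in> F" if "x \<in> ?c" for x
      using that gsv_coeffs_F by (intro mult_subgroup_power_int[OF group]) blast
    then show ?thesis
      unfolding g using c gsv_coeffs_F by (simp add: prod other.prod power_int other.power_int subset_iff)
  qed
  have "subsemifield_hom F F' \<psi>" "subsemifield_hom F F' \<psi>'" by unfold_locales
  from this[unfolded seed_semifield_def[of "gsv_P k l"]] show ?thesis
  proof (rule subsemifield_hom_eqI)
    fix g assume "g \<in> clv (gsv_seed k l) ` {1..num (gsv_seed k l)} \<union> gsv_P k l"
    then show "\<psi> g = \<psi>' g"
      using P psi_x other.psi_x by (auto simp: gsv_seed_def)
  qed (use assms(2) in \<open>simp add: seed_semifield_def\<close>)
qed

end

section \<open>Existence by substitution into independent generators\<close>

lemma psi_star_exists: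
  assumes kl: "2 \<le> k" "k < l" and indep: "alg_independent (gsv_index k l) (gsv_family k l)"
  shows "\<exists>\<psi>. is_psi_star k l \<psi>"
proof -
  let ?I = "gsv_index k l" and ?g = "gsv_family k l"
  let ?F = "seed_semifield (gsv_P k l) (gsv_seed k l)" and ?F' = "seed_semifield (cyc_P k l) (cyc_seed k l)"
  let ?R = "\<Prod>i=1..l. cyc_x (Nkl k l + i)"
  have l: "0 < l" using kl by simp
  \<comment> \<open>The labels 0, 1, 2, 3 stand for x_i, M_{i,i}, M_{i,i+k} and c_s as in
    \<open>gsv_family\<close>; \<open>h\<close> is the prescribed image of each.\<close>
  define h where "h = (\<lambda>(a :: nat, i). if a = 0 then image_x k l i
    else if a = 1 then cyc_frozen k l (int i - 1)
    else if a = 2 then cyc_frozen k l (int i + int k) else cyc_z k i * ?R)"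
  have F': "subsemifield ?F'" by (rule subsemifield_cyc[OF l])
  then have G': "mult_subgroup ?F'" by (simp add: subsemifield_def)
  then have prod: "a * b \<in> ?F'" if "a \<in> ?F'" "b \<in> ?F'" for a b
    using that by (simp add: mult_subgroup_def)
  have P': "cyc_P k l \<subseteq> ?F'"
    by (auto simp: seed_semifield_def intro: subtraction_free.gen)
  then have fr: "cyc_frozen k l m \<in> ?F'" for m
    using cyc_frozen_in_cyc_P[OF l] by blast
  have hF: "h v \<in> ?F'" if "v \<in> ?I" for v
  proof -
    have "image_x k l i \<in> ?F'" if "i \<in> {1..Nkl k l}" for i
    proof -
      have "cyc_x i \<in> ?F'"
        using that by (auto simp: seed_semifield_def cyc_seed_def intro!: subtraction_free.gen)
      then show ?thesis
        using that fr by (auto simp: image_x_def intro!: prod mult_subgroup_prod[OF G'])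
    qed
    moreover have "cyc_z k s * ?R \<in> ?F'" if "s \<in> {1..k - 1}" for s
    proof -
      have "?R \<in> ?F'"
        using P' by (intro mult_subgroup_prod[OF G'] subsetD[OF P'] cyc_P_gen) auto
      moreover have "cyc_z k s \<in> ?F'"
        using that by (intro subsetD[OF P'] cyc_P_gen) auto
      ultimately show ?thesis by (rule prod[rotated])
    qed
    ultimately show ?thesis
      using that fr by (auto simp: h_def gsv_index_def)
  qed
  obtain \<psi> where hom: "semifield_hom (positive_quotients ?I ?g) ?F' \<psi>"
    and \<psi>: "\<And>v. v \<in> ?I \<Longrightarrow> \<psi> (?g v) = h v"
    using substitution_hom[OF indep F', of h] hF by blast
  have Q: "subsemifield (positive_quotients ?I ?g)"
    by (rule subsemifield_positive_quotients[OF indep])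
  have fam: "?g v \<in> positive_quotients ?I ?g" if "v \<in> ?I" for v
    using that by (rule family_in_positive_quotients)
  have x: "gsv_x k l i = ?g (0, i)" "(0, i) \<in> ?I" if "i \<in> {1..Nkl k l}" for i
    using that by (auto simp: gsv_family_def gsv_index_def)
  have d: "band k l (int i) (int i) = ?g (1, i)" "(1, i) \<in> ?I"
    and u: "band k l (int i) (int i + int k) = ?g (2, i)" "(2, i) \<in> ?I" if "i \<in> {1..l}" for i
    using that by (auto simp: gsv_family_def gsv_index_def)
  have c: "gsv_c k l s = ?g (3, s)" "(3, s) \<in> ?I" if "s \<in> {1..k - 1}" for s
    using that by (auto simp: gsv_family_def gsv_index_def)
  have coeffs: "gsv_coeffs k l \<subseteq> positive_quotients ?I ?g"
    unfolding gsv_coeffs_def using fam d u c by auto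
  have "gsv_P k l \<subseteq> positive_quotients ?I ?g"
    unfolding gsv_P_eq using Q coeffs by (intro laurent_monomials_subset) (simp_all add: subsemifield_def)
  then have "clv (gsv_seed k l) ` {1..num (gsv_seed k l)} \<union> gsv_P k l \<subseteq> positive_quotients ?I ?g"
    using x fam by (auto simp: gsv_seed_def)
  then have "?F \<subseteq> positive_quotients ?I ?g"
    unfolding seed_semifield_def by (rule subtraction_free_subset[OF Q])
  \<comment> \<open>The substitution is defined on all positive quotients of the family, which
    contain the GSV semifield, so it restricts.\<close>
  then have hom': "semifield_hom ?F ?F' \<psi>"
    using hom by (auto simp: semifield_hom_def)
  \<comment> \<open>Values are prescribed for rows 1 to l only; periodicity of the band matrix and
    of f carries them to every integer.\<close>
  have diag: "\<psi> (band k l i i) = cyc_frozen k l (i - 1)" for i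
  proof -
    let ?r = "residue l i"
    have r: "?r \<in> {1..l}" by (rule residue_bounds[OF l])
    have "\<psi> (band k l i i) = cyc_frozen k l (int ?r - 1)"
      using band_residue[OF l, of k i 0] d[OF r] \<psi>[OF d(2)[OF r]] by (simp add: h_def)
    also have "\<dots> = cyc_frozen k l (i - 1)"
      by (intro cyc_frozen_cong mod_diff_cong residue_mod[OF l] refl)
    finally show ?thesis .
  qed
  have super: "\<psi> (band k l (i - int k - 1) (i - 1)) = cyc_frozen k l (i - 1)" for i
  proof -
    let ?r = "residue l (i - int k - 1)"
    have r: "?r \<in> {1..l}" by (rule residue_bounds[OF l])
    have "\<psi> (band k l (i - int k - 1) (i - int k - 1 + int k)) = cyc_frozen k l (int ?r + int k)"
      using band_residue[OF l, of k "i - int k - 1" "int k"] u[OF r] \<psi>[OF u(2)[OF r]] by (simp add: h_def)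
    also have "\<dots> = cyc_frozen k l (i - int k - 1 + int k)"
      by (intro cyc_frozen_cong mod_add_cong residue_mod[OF l] refl)
    finally show ?thesis by simp
  qed
  have "is_psi_star k l \<psi>"
    unfolding is_psi_star_def
    using hom' diag super x c \<psi>
    by (auto simp: h_def image_x_def cyc_frozen_def)
  then show ?thesis by blast
qed

text \<open>\<open>is_psi_star\<close> is a specification of \<psi>. The second clause makes it
  determine \<psi> on the whole semifield, and the third shows that it can be met when the
  generators are independent.\<close>

theorem lemma8p2:
  fixes k l :: nat
  assumes "2 \<le> k" and "k < l"
  shows
    "(\<forall>\<psi>. is_psi_star k l \<psi> \<longrightarrow>
        quasi_homomorphism (gsv_P k l) (gsv_seed k l) (cyc_P k l) (cyc_seed k l) \<psi> \<and>
        \<psi> ` gsv_P k l \<subseteq> cyc_P k l \<and>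
        (\<forall>i\<in>{1..Nkl k l}. \<psi> (gsv_x k l i) / cyc_x i \<in> cyc_P k l) \<and>
        (\<forall>i\<in>{1..Nkl k l}. \<forall>s\<in>{1..seed_degree k i}.
           \<psi> (gsv_yhat k l i s) = cyc_yhat k l i s)) \<and>
     (\<forall>\<psi> \<psi>'. is_psi_star k l \<psi> \<longrightarrow> is_psi_star k l \<psi>' \<longrightarrow>
        (\<forall>f\<in>seed_semifield (gsv_P k l) (gsv_seed k l). \<psi> f = \<psi>' f)) \<and>
     (alg_independent (gsv_index k l) (gsv_family k l) \<longrightarrow> (\<exists>\<psi>. is_psi_star k l \<psi>))"
proof -
  have star: "psi_star k l \<psi>" if "is_psi_star k l \<psi>" for \<psi>
    using assms that by unfold_locales
  then have "\<psi> f = \<psi>' f"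
    if "is_psi_star k l \<psi>" "is_psi_star k l \<psi>'" "f \<in> seed_semifield (gsv_P k l) (gsv_seed k l)" for \<psi> \<psi>' f
    using that psi_star.psi_unique by blast
  then show ?thesis
    using star psi_star.psi_quasi_homomorphism psi_star.psi_P psi_star.psi_x_ratio psi_star.psi_yhat
      psi_star_exists[OF assms] by (intro conjI allI impI ballI) simp_all
qed

end
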